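(* Any three-dimensional paracontact metric structure $(\varphi,\xi,\eta,g)$, in terms of local Darboux coordinates $(x,y,z)$, is explicitly described by $$\xi=2\partial_z,\qquad \eta=\tfrac12(dz-y\,dx),$$ and, with respect to $\{\partial_x,\partial_y,\partial_z\}$, $$g=\frac14\begin{pmatrix} a & b & -y \\ {b} & c & 0 \\ -y & 0 & 1 \end{pmatrix},\qquad \varphi=\begin{pmatrix} -b & -c & 0 \\ {a}-y^2 & b & 0 \\ -by & -cy & 0 \end{pmatrix},$$ for some smooth functions $a,b,c$ satisfying $ac-b^2-cy^2=-1$. In particular, (i) the structure is paraSasakian if and only if the functions $a,b,c$ do not depend on $z$; (ii) $h^2=0$ (equivalently, $\mathrm{tr}\,h^2=0$) if and only if $b_z^2-a_zc_z=0$.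
   Context: An almost paracontact structure on a connected smooth $3$-manifold is a triple $(\varphi,\xi,\eta)$ of a $(1,1)$-tensor, a global vector field and a $1$-form with $\varphi(\xi)=0$, $\eta\circ\varphi=0$, $\eta(\xi)=1$, $\varphi^2=\mathrm{Id}-\eta\otimes\xi$, and such that the $\pm1$-eigenbundles of $\varphi|_{\ker\eta}$ both have rank $1$. It is a paracontact metric structure together with a pseudo-Riemannian metric $g$ if $g(\varphi X,\varphi Y)=-g(X,Y)+\eta(X)\eta(Y)$ and $d\eta(X,Y)=g(X,\varphi Y)$ for all $X,Y$, with the convention $d\eta(X,Y)=\frac12\big(X\eta(Y)-Y\eta(X)-\eta([X,Y])\big)$. The structure is normal if $[\varphi,\varphi]-2d\eta\otimes\xi=0$, where $[\varphi,\varphi]$ is the Nijenhuis torsion; a paraSasakian structure is a normal paracontact metric structure. $h=\frac12\mathcal L_\xi\varphi$. The matrix of $\varphi$ acts on column vectors of components (its columns are the components of $\varphi\partial_x,\varphi\partial_y,\varphi\partial_z$). Darboux coordinates for the contact form $\eta$ are local coordinates $(x,y,z)$ in which $\eta=\frac12(dz-y\,dx)$; they exist around every point. Subscript $z$ denotes $\partial/\partial z$. *)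

theory Defs
  imports "HOL-Analysis.Analysis"
begin

section \<open>Smooth maps between open subsets of normed spaces\<close>

text \<open>\<open>Ck_on k S f\<close>: all iterated directional derivatives of \<open>f\<close> of order at most \<open>k\<close>
  exist and are continuous on \<open>S\<close>. Only used for open \<open>S\<close>, since the derivatives are two-sided.\<close>

fun Ck_on ::
    "nat \<Rightarrow> 'a::real_normed_vector set \<Rightarrow> ('a \<Rightarrow> 'b::real_normed_vector) \<Rightarrow> bool" where
  "Ck_on 0 S f \<longleftrightarrow> continuous_on S f"
| "Ck_on (Suc k) S f \<longleftrightarrow>
     (\<forall>u\<in>S. f differentiable (at u)) \<and>
     (\<forall>v. Ck_on k S (\<lambda>u. frechet_derivative f (at u) v))"

definition smooth_on ::
    "'a::real_normed_vector set \<Rightarrow> ('a \<Rightarrow> 'b::real_normed_vector) \<Rightarrow> bool" where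
  "smooth_on S f \<longleftrightarrow> (\<forall>k. Ck_on k S f)"


section \<open>Calculus of tensor fields on open subsets of \<open>\<real>\<^sup>3\<close>\<close>

text \<open>Vector fields and 1-forms are given by their components, (1,1)-tensor fields and
  bilinear forms by their matrices, with respect to the coordinate frame. The value of a 1-form
  \<open>\<alpha>\<close> on a vector \<open>v\<close> is \<open>\<alpha> \<bullet> v\<close>, and a (1,1)-tensor acts on column vectors by \<open>(*v)\<close>.\<close>

type_synonym field3 = "real^3 \<Rightarrow> real^3"
type_synonym tensor3 = "real^3 \<Rightarrow> real^3^3"

definition deriv_along :: "field3 \<Rightarrow> (real^3 \<Rightarrow> real) \<Rightarrow> real^3 \<Rightarrow> real" where
  "deriv_along X f u = frechet_derivative f (at u) (X u)"

definition lie_bracket :: "field3 \<Rightarrow> field3 \<Rightarrow> field3" where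
  "lie_bracket X Y u =
     frechet_derivative Y (at u) (X u) - frechet_derivative X (at u) (Y u)"

definition app :: "tensor3 \<Rightarrow> field3 \<Rightarrow> field3" where
  "app \<phi> X u = \<phi> u *v X u"

definition ext_deriv :: "field3 \<Rightarrow> field3 \<Rightarrow> field3 \<Rightarrow> real^3 \<Rightarrow> real" where
  "ext_deriv \<eta> X Y u =
     (1/2) * (deriv_along X (\<lambda>p. \<eta> p \<bullet> Y p) u - deriv_along Y (\<lambda>p. \<eta> p \<bullet> X p) u
              - \<eta> u \<bullet> lie_bracket X Y u)"

definition nijenhuis :: "tensor3 \<Rightarrow> field3 \<Rightarrow> field3 \<Rightarrow> field3" where
  "nijenhuis \<phi> X Y u =
     app \<phi> (app \<phi> (lie_bracket X Y)) u + lie_bracket (app \<phi> X) (app \<phi> Y) u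
     - app \<phi> (lie_bracket (app \<phi> X) Y) u - app \<phi> (lie_bracket X (app \<phi> Y)) u"

definition lie_deriv :: "field3 \<Rightarrow> tensor3 \<Rightarrow> field3 \<Rightarrow> field3" where
  "lie_deriv \<xi> \<phi> X u = lie_bracket \<xi> (app \<phi> X) u - app \<phi> (lie_bracket \<xi> X) u"

text \<open>The matrix of \<open>h = 1/2 L\<^sub>\<xi> \<phi>\<close>. As the Lie derivative of a tensor is a tensor, its columns
  are obtained by evaluating it on the (constant) coordinate vector fields.\<close>

definition h_tensor :: "tensor3 \<Rightarrow> field3 \<Rightarrow> tensor3" where
  "h_tensor \<phi> \<xi> u = matrix (\<lambda>v. (1/2) *\<^sub>R lie_deriv \<xi> \<phi> (\<lambda>_. v) u)"

definition almost_paracontact_on ::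
    "(real^3) set \<Rightarrow> tensor3 \<Rightarrow> field3 \<Rightarrow> field3 \<Rightarrow> bool" where
  "almost_paracontact_on S \<phi> \<xi> \<eta> \<longleftrightarrow>
     smooth_on S \<phi> \<and> smooth_on S \<xi> \<and> smooth_on S \<eta> \<and>
     (\<forall>u\<in>S. \<phi> u *v \<xi> u = 0 \<and>
            (\<forall>v. \<eta> u \<bullet> (\<phi> u *v v) = 0) \<and>
            \<eta> u \<bullet> \<xi> u = 1 \<and>
            (\<forall>v. \<phi> u *v (\<phi> u *v v) = v - (\<eta> u \<bullet> v) *\<^sub>R \<xi> u) \<and>
            dim {v. \<eta> u \<bullet> v = 0 \<and> \<phi> u *v v = v} = 1 \<and>
            dim {v. \<eta> u \<bullet> v = 0 \<and> \<phi> u *v v = - v} = 1)"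

definition pseudo_riemannian_on :: "(real^3) set \<Rightarrow> tensor3 \<Rightarrow> bool" where
  "pseudo_riemannian_on S g \<longleftrightarrow>
     smooth_on S g \<and> (\<forall>u\<in>S. transpose (g u) = g u \<and> invertible (g u))"

definition paracontact_metric_on ::
    "(real^3) set \<Rightarrow> tensor3 \<Rightarrow> field3 \<Rightarrow> field3 \<Rightarrow> tensor3 \<Rightarrow> bool" where
  "paracontact_metric_on S \<phi> \<xi> \<eta> g \<longleftrightarrow>
     almost_paracontact_on S \<phi> \<xi> \<eta> \<and> pseudo_riemannian_on S g \<and>
     (\<forall>u\<in>S. \<forall>v w. (\<phi> u *v v) \<bullet> (g u *v (\<phi> u *v w)) =
                     - (v \<bullet> (g u *v w)) + (\<eta> u \<bullet> v) * (\<eta> u \<bullet> w)) \<and>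
     (\<forall>X Y. smooth_on S X \<longrightarrow> smooth_on S Y \<longrightarrow>
        (\<forall>u\<in>S. ext_deriv \<eta> X Y u = X u \<bullet> (g u *v (\<phi> u *v Y u))))"

definition normal_on :: "(real^3) set \<Rightarrow> tensor3 \<Rightarrow> field3 \<Rightarrow> field3 \<Rightarrow> bool" where
  "normal_on S \<phi> \<xi> \<eta> \<longleftrightarrow>
     (\<forall>X Y. smooth_on S X \<longrightarrow> smooth_on S Y \<longrightarrow>
        (\<forall>u\<in>S. nijenhuis \<phi> X Y u - (2 * ext_deriv \<eta> X Y u) *\<^sub>R \<xi> u = 0))"

definition parasasakian_on ::
    "(real^3) set \<Rightarrow> tensor3 \<Rightarrow> field3 \<Rightarrow> field3 \<Rightarrow> tensor3 \<Rightarrow> bool" where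
  "parasasakian_on S \<phi> \<xi> \<eta> g \<longleftrightarrow> paracontact_metric_on S \<phi> \<xi> \<eta> g \<and> normal_on S \<phi> \<xi> \<eta>"


section \<open>Smooth 3-manifolds and tensor fields on them\<close>

text \<open>A chart is a pair of its domain and its coordinate map.\<close>

type_synonym 'm chart = "'m set \<times> ('m \<Rightarrow> real^3)"

definition chart_image :: "'m chart \<Rightarrow> (real^3) set" where
  "chart_image \<kappa> = snd \<kappa> ` fst \<kappa>"

definition is_chart :: "'m topology \<Rightarrow> 'm chart \<Rightarrow> bool" where
  "is_chart M \<kappa> \<longleftrightarrow>
     openin M (fst \<kappa>) \<and> open (chart_image \<kappa>) \<and>
     homeomorphic_map (subtopology M (fst \<kappa>)) (top_of_set (chart_image \<kappa>)) (snd \<kappa>)"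

definition transition :: "'m chart \<Rightarrow> 'm chart \<Rightarrow> real^3 \<Rightarrow> real^3" where
  "transition \<kappa> \<kappa>' u = snd \<kappa>' (inv_into (fst \<kappa>) (snd \<kappa>) u)"

definition overlap :: "'m chart \<Rightarrow> 'm chart \<Rightarrow> (real^3) set" where
  "overlap \<kappa> \<kappa>' = snd \<kappa> ` (fst \<kappa> \<inter> fst \<kappa>')"

definition compatible :: "'m chart \<Rightarrow> 'm chart \<Rightarrow> bool" where
  "compatible \<kappa> \<kappa>' \<longleftrightarrow>
     smooth_on (overlap \<kappa> \<kappa>') (transition \<kappa> \<kappa>') \<and>
     smooth_on (overlap \<kappa>' \<kappa>) (transition \<kappa>' \<kappa>)"

definition covers :: "'m topology \<Rightarrow> 'm chart set \<Rightarrow> bool" where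
  "covers M D \<longleftrightarrow> (\<Union>\<kappa>\<in>D. fst \<kappa>) = topspace M"

text \<open>\<open>A\<close> is the maximal atlas.\<close>

definition smooth_3_manifold :: "'m topology \<Rightarrow> 'm chart set \<Rightarrow> bool" where
  "smooth_3_manifold M A \<longleftrightarrow>
     Hausdorff_space M \<and> second_countable M \<and>
     (\<forall>\<kappa>\<in>A. is_chart M \<kappa>) \<and> covers M A \<and>
     (\<forall>\<kappa>\<in>A. \<forall>\<kappa>'\<in>A. compatible \<kappa> \<kappa>') \<and>
     (\<forall>\<kappa>. is_chart M \<kappa> \<and> (\<forall>\<kappa>'\<in>A. compatible \<kappa> \<kappa>') \<longrightarrow> \<kappa> \<in> A)"

definition jacobian :: "'m chart \<Rightarrow> 'm chart \<Rightarrow> tensor3" where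
  "jacobian \<kappa> \<kappa>' u = matrix (frechet_derivative (transition \<kappa> \<kappa>') (at u))"

text \<open>A tensor field on the manifold is given by its components in every chart of the maximal
  atlas (as functions of the coordinates of that chart), related by the transformation law of its
  type. Smoothness is imposed chart by chart in the structures below.\<close>

definition vector_field :: "'m chart set \<Rightarrow> ('m chart \<Rightarrow> field3) \<Rightarrow> bool" where
  "vector_field A \<xi> \<longleftrightarrow>
     (\<forall>\<kappa>\<in>A. \<forall>\<kappa>'\<in>A. \<forall>u\<in>overlap \<kappa> \<kappa>'.
        \<xi> \<kappa>' (transition \<kappa> \<kappa>' u) = jacobian \<kappa> \<kappa>' u *v \<xi> \<kappa> u)"

definition one_form :: "'m chart set \<Rightarrow> ('m chart \<Rightarrow> field3) \<Rightarrow> bool" where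
  "one_form A \<eta> \<longleftrightarrow>
     (\<forall>\<kappa>\<in>A. \<forall>\<kappa>'\<in>A. \<forall>u\<in>overlap \<kappa> \<kappa>'.
        \<eta> \<kappa> u = \<eta> \<kappa>' (transition \<kappa> \<kappa>' u) v* jacobian \<kappa> \<kappa>' u)"

definition tensor_1_1 :: "'m chart set \<Rightarrow> ('m chart \<Rightarrow> tensor3) \<Rightarrow> bool" where
  "tensor_1_1 A \<phi> \<longleftrightarrow>
     (\<forall>\<kappa>\<in>A. \<forall>\<kappa>'\<in>A. \<forall>u\<in>overlap \<kappa> \<kappa>'.
        \<phi> \<kappa>' (transition \<kappa> \<kappa>' u) ** jacobian \<kappa> \<kappa>' u = jacobian \<kappa> \<kappa>' u ** \<phi> \<kappa> u)"

definition bilinear_field :: "'m chart set \<Rightarrow> ('m chart \<Rightarrow> tensor3) \<Rightarrow> bool" where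
  "bilinear_field A g \<longleftrightarrow>
     (\<forall>\<kappa>\<in>A. \<forall>\<kappa>'\<in>A. \<forall>u\<in>overlap \<kappa> \<kappa>'.
        g \<kappa> u =
          transpose (jacobian \<kappa> \<kappa>' u) ** g \<kappa>' (transition \<kappa> \<kappa>' u) ** jacobian \<kappa> \<kappa>' u)"

definition paracontact_metric ::
    "'m chart set \<Rightarrow> ('m chart \<Rightarrow> tensor3) \<Rightarrow> ('m chart \<Rightarrow> field3) \<Rightarrow>
     ('m chart \<Rightarrow> field3) \<Rightarrow> ('m chart \<Rightarrow> tensor3) \<Rightarrow> bool" where
  "paracontact_metric A \<phi> \<xi> \<eta> g \<longleftrightarrow>
     tensor_1_1 A \<phi> \<and> vector_field A \<xi> \<and> one_form A \<eta> \<and> bilinear_field A g \<and>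
     (\<forall>\<kappa>\<in>A. paracontact_metric_on (chart_image \<kappa>) (\<phi> \<kappa>) (\<xi> \<kappa>) (\<eta> \<kappa>) (g \<kappa>))"

definition parasasakian ::
    "'m chart set \<Rightarrow> ('m chart \<Rightarrow> tensor3) \<Rightarrow> ('m chart \<Rightarrow> field3) \<Rightarrow>
     ('m chart \<Rightarrow> field3) \<Rightarrow> ('m chart \<Rightarrow> tensor3) \<Rightarrow> bool" where
  "parasasakian A \<phi> \<xi> \<eta> g \<longleftrightarrow>
     paracontact_metric A \<phi> \<xi> \<eta> g \<and>
     (\<forall>\<kappa>\<in>A. normal_on (chart_image \<kappa>) (\<phi> \<kappa>) (\<xi> \<kappa>) (\<eta> \<kappa>))"


section \<open>Darboux coordinates\<close>

text \<open>The coordinates \<open>x, y, z\<close> are \<open>u$1, u$2, u$3\<close>, and \<open>axis i 1\<close> is the \<open>i\<close>-th coordinate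
  vector; the components below are those of \<open>\<eta> = 1/2 (dz - y dx)\<close>.\<close>

definition darboux_chart :: "'m chart set \<Rightarrow> ('m chart \<Rightarrow> field3) \<Rightarrow> 'm chart \<Rightarrow> bool" where
  "darboux_chart A \<eta> \<kappa> \<longleftrightarrow>
     \<kappa> \<in> A \<and> (\<forall>u\<in>chart_image \<kappa>. \<eta> \<kappa> u = (1/2) *\<^sub>R (axis 3 1 - u$2 *\<^sub>R axis 1 1))"

definition partial_z :: "(real^3 \<Rightarrow> real) \<Rightarrow> real^3 \<Rightarrow> real" where
  "partial_z f u = frechet_derivative f (at u) (axis 3 1)"

text \<open>Since \<open>S\<close> need not be convex in the \<open>z\<close>-direction, only points joined by a vertical segment
  inside \<open>S\<close> are compared: on different components of \<open>S\<close> over the same \<open>(x, y)\<close> a function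
  with vanishing \<open>z\<close>-derivative may take different values.\<close>

definition indep_of_z :: "(real^3) set \<Rightarrow> (real^3 \<Rightarrow> real) \<Rightarrow> bool" where
  "indep_of_z S f \<longleftrightarrow>
     (\<forall>u t. closed_segment u (u + t *\<^sub>R axis 3 1) \<subseteq> S \<longrightarrow> f (u + t *\<^sub>R axis 3 1) = f u)"

end

theory Submission
  imports Defs
begin

text \<open>In Darboux coordinates \<open>d\<eta>(\<partial>\<^sub>x, \<partial>\<^sub>y) = 1/4\<close> is the only nonzero component of \<open>d\<eta>\<close>, so
  \<open>d\<eta>(\<cdot>, \<xi>) = 0\<close> forces \<open>\<xi> = 2 \<partial>\<^sub>z\<close>, and \<open>g(\<cdot>, \<xi>) = \<eta>\<close> gives the last column of \<open>g\<close>. Since \<open>\<phi>\<^sup>2 = 1\<close>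
  modulo \<open>\<xi>\<close>, the equation \<open>g \<phi> = d\<eta>\<close> can be solved for \<open>\<phi>\<close>. Moreover \<open>h = \<partial>\<^sub>z \<phi>\<close>, whose upper left
  block is traceless and hence squares to a multiple of the identity. Evaluating the normality
  condition on \<open>\<partial>\<^sub>z\<close> yields \<open>\<phi> \<partial>\<^sub>z\<phi> = 0\<close>, so \<open>\<partial>\<^sub>z\<phi> = 0\<close>; conversely, if \<open>\<partial>\<^sub>z\<phi> = 0\<close>, the components
  of the condition are combinations of the constraint on \<open>a, b, c\<close> and its \<open>x\<close>- and \<open>y\<close>-derivatives.
  Both conditions are tensorial, because the second derivatives of a coordinate change are
  symmetric, so they may be tested on any cover by Darboux charts.\<close>

section \<open>Symmetry of second derivatives of smooth maps\<close>

lemma has_derivative_along_line: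
  assumes "f differentiable (at (p + t *\<^sub>R v))"
  shows "((\<lambda>s. f (p + s *\<^sub>R v)) has_derivative (\<lambda>h. h *\<^sub>R frechet_derivative f (at (p + t *\<^sub>R v)) v)) (at t)"
proof -
  let ?D = "frechet_derivative f (at (p + t *\<^sub>R v))"
  have D: "(f has_derivative ?D) (at (p + t *\<^sub>R v))"
    using assms frechet_derivative_works by blast
  have "((\<lambda>s. p + s *\<^sub>R v) has_derivative (\<lambda>h. h *\<^sub>R v)) (at t)"
    by (auto intro!: derivative_eq_intros)
  from has_derivative_compose[OF this D]
  show ?thesis
    by (simp add: linear_cmul[OF linear_frechet_derivative[OF assms]])
qed

lemma mvt_along_line:
  fixes f :: "'a::real_normed_vector \<Rightarrow> real"
  assumes "0 < d" and "\<And>t. 0 \<le> t \<Longrightarrow> t \<le> d \<Longrightarrow> f differentiable (at (p + t *\<^sub>R v))"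
  obtains t where "0 < t" "t < d"
    "f (p + d *\<^sub>R v) - f p = d * frechet_derivative f (at (p + t *\<^sub>R v)) v"
proof -
  have "((\<lambda>s. f (p + s *\<^sub>R v)) has_derivative
      (\<lambda>h. h *\<^sub>R frechet_derivative f (at (p + t *\<^sub>R v)) v)) (at t within {0..d})"
    if "0 \<le> t" "t \<le> d" for t
    using has_derivative_along_line[OF assms(2)[OF that]] has_derivative_at_withinI by blast
  from mvt_simple[OF assms(1) this] that show ?thesis
    by auto
qed

text \<open>The mean value theorem is applied twice: along \<open>v\<close> to the increment
  \<open>f (p + d *\<^sub>R w) - f p\<close>, then along \<open>w\<close> to the derivative of
  \<open>f\<close> in direction \<open>v\<close>. The intermediate point lies in the parallelogram
  with sides \<open>d *\<^sub>R v\<close> and \<open>d *\<^sub>R w\<close> at \<open>u\<close>,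
  whence the distance bound.\<close>

lemma second_difference_eq:
  fixes f :: "'a::real_normed_vector \<Rightarrow> real"
  assumes S: "ball u r \<subseteq> S" and d: "0 < d" "d * (norm v + norm w) < r"
    and f: "\<And>p. p \<in> S \<Longrightarrow> f differentiable (at p)"
    and fv: "\<And>p. p \<in> S \<Longrightarrow> (\<lambda>p. frechet_derivative f (at p) v) differentiable (at p)"
  obtains p where "dist p u \<le> d * (norm v + norm w)"
    "f (u + d *\<^sub>R v + d *\<^sub>R w) - f (u + d *\<^sub>R v) - f (u + d *\<^sub>R w) + f u
      = d * (d * frechet_derivative (\<lambda>p. frechet_derivative f (at p) v) (at p) w)"
proof -
  let ?fv = "\<lambda>p. frechet_derivative f (at p) v"
  have near: "dist (u + s *\<^sub>R v + t *\<^sub>R w) u \<le> d * (norm v + norm w)"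
    if "0 \<le> s" "s \<le> d" "0 \<le> t" "t \<le> d" for s t
  proof -
    have "norm (s *\<^sub>R v + t *\<^sub>R w) \<le> s * norm v + t * norm w"
      using norm_triangle_ineq[of "s *\<^sub>R v" "t *\<^sub>R w"] that by simp
    also have "\<dots> \<le> d * norm v + d * norm w"
      using that by (intro add_mono mult_right_mono) auto
    finally show ?thesis
      by (simp add: dist_norm algebra_simps)
  qed
  have inS: "u + s *\<^sub>R v + t *\<^sub>R w \<in> S" if "0 \<le> s" "s \<le> d" "0 \<le> t" "t \<le> d" for s t
  proof -
    have "u + s *\<^sub>R v + t *\<^sub>R w \<in> ball u r"
      unfolding mem_ball using near[OF that] d(2) by (simp add: dist_commute)
    with S show ?thesis
      by blast
  qed
  have inS0: "u + s *\<^sub>R v \<in> S" if "0 \<le> s" "s \<le> d" for s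
    using inS[OF that, of 0] d(1) by simp
  let ?k = "\<lambda>p. f (p + d *\<^sub>R w) - f p"
  have k: "(?k has_derivative (\<lambda>h. frechet_derivative f (at (p + d *\<^sub>R w)) h
      - frechet_derivative f (at p) h)) (at p)"
    if "p \<in> S" "p + d *\<^sub>R w \<in> S" for p
  proof -
    have "((\<lambda>p. f (p + d *\<^sub>R w)) has_derivative frechet_derivative f (at (p + d *\<^sub>R w))) (at p)"
      by (rule has_derivative_compose[where f = "\<lambda>p. p + d *\<^sub>R w" and f' = "\<lambda>h. h"])
        (use f[OF that(2)] frechet_derivative_works in \<open>auto intro!: derivative_eq_intros\<close>)
    then show ?thesis
      using f[OF that(1)] frechet_derivative_works by (intro has_derivative_diff) auto
  qed
  have kd: "?k differentiable (at (u + t *\<^sub>R v))" if "0 \<le> t" "t \<le> d" for t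
    using k[OF inS0 inS] that d(1) unfolding differentiable_def by fastforce
  obtain s where s: "0 < s" "s < d"
    "?k (u + d *\<^sub>R v) - ?k u = d * frechet_derivative ?k (at (u + s *\<^sub>R v)) v"
    using mvt_along_line[of d ?k u v] kd d(1) by blast
  \<comment> \<open>The derivative of the increment is the increment of the derivative, which is the
    input of the second mean value step.\<close>
  have "frechet_derivative ?k (at (u + s *\<^sub>R v)) v = ?fv (u + s *\<^sub>R v + d *\<^sub>R w) - ?fv (u + s *\<^sub>R v)"
    using fun_cong[OF frechet_derivative_at[OF k[OF inS0[of s] inS[of s d]]], of v] s d(1) by simp
  moreover obtain t where t: "0 < t" "t < d"
    "?fv (u + s *\<^sub>R v + d *\<^sub>R w) - ?fv (u + s *\<^sub>R v)
      = d * frechet_derivative ?fv (at (u + s *\<^sub>R v + t *\<^sub>R w)) w"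
    by (rule mvt_along_line[of d ?fv "u + s *\<^sub>R v" w]) (use fv inS s d(1) in auto)
  ultimately have "f (u + d *\<^sub>R v + d *\<^sub>R w) - f (u + d *\<^sub>R v) - f (u + d *\<^sub>R w) + f u
      = d * (d * frechet_derivative ?fv (at (u + s *\<^sub>R v + t *\<^sub>R w)) w)"
    using s(3) by simp
  then show ?thesis
    using that near[of s t] s t by simp
qed

text \<open>The second difference over the parallelogram with sides \<open>d *\<^sub>R v\<close> and
  \<open>d *\<^sub>R w\<close> is unchanged when \<open>v\<close> and \<open>w\<close> are
  exchanged. It equals \<open>d * d\<close> times either mixed derivative at some point near
  \<open>u\<close>, so by continuity the two cannot differ at \<open>u\<close>.\<close>

lemma symmetric_second_derivative_real:
  fixes f :: "'a::real_normed_vector \<Rightarrow> real"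
  assumes S: "open S" "u \<in> S"
    and f: "\<And>p. p \<in> S \<Longrightarrow> f differentiable (at p)"
    and fd: "\<And>v p. p \<in> S \<Longrightarrow> (\<lambda>p. frechet_derivative f (at p) v) differentiable (at p)"
    and c: "\<And>v w. continuous_on S (\<lambda>p. frechet_derivative (\<lambda>p. frechet_derivative f (at p) v) (at p) w)"
  shows "frechet_derivative (\<lambda>p. frechet_derivative f (at p) v) (at u) w
       = frechet_derivative (\<lambda>p. frechet_derivative f (at p) w) (at u) v"
proof (rule ccontr)
  define F where "F v w p = frechet_derivative (\<lambda>p. frechet_derivative f (at p) v) (at p) w" for v w p
  assume "\<not> ?thesis"
  then have ne: "F v w u \<noteq> F w v u"
    by (simp add: F_def)
  \<comment> \<open>Half the gap: two errors below \<open>e\<close> cannot bridge it.\<close>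
  define e where "e = dist (F v w u) (F w v u) / 2"
  have e: "e > 0"
    using ne by (simp add: e_def)
  have cont: "isCont (F v w) u" for v w
    using c S unfolding F_def by (simp add: continuous_on_eq_continuous_at)
  obtain r1 where r1: "r1 > 0" "\<And>p. dist p u < r1 \<Longrightarrow> dist (F v w p) (F v w u) < e"
    using cont[of v w] e unfolding continuous_at_eps_delta by metis
  obtain r2 where r2: "r2 > 0" "\<And>p. dist p u < r2 \<Longrightarrow> dist (F w v p) (F w v u) < e"
    using cont[of w v] e unfolding continuous_at_eps_delta by metis
  obtain r3 where r3: "r3 > 0" "ball u r3 \<subseteq> S"
    using S openE by blast
  define r where "r = min r1 (min r2 r3)"
  have r: "r > 0" "ball u r \<subseteq> S" "r \<le> r1" "r \<le> r2"
    using r1(1) r2(1) r3 by (auto simp: r_def)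
  define N where "N = norm v + norm w"
  \<comment> \<open>Then \<open>d * N \<le> r / 2\<close>, so the intermediate points stay in the
    ball; the summand 1 keeps the denominator positive also for \<open>N = 0\<close>.\<close>
  define d where "d = r / (2 * (N + 1))"
  have N: "N \<ge> 0"
    by (simp add: N_def)
  have d: "0 < d" "d * N < r"
    using r(1) N by (auto simp: d_def field_simps add_nonneg_pos)
  \<comment> \<open>The directions are rebound here, so that the same \<open>d\<close> serves both
    orders of differentiation.\<close>
  have diff: "\<exists>p. dist p u \<le> d * N \<and> f (u + d *\<^sub>R v + d *\<^sub>R w) - f (u + d *\<^sub>R v)
      - f (u + d *\<^sub>R w) + f u = d * (d * F v w p)" if "norm v + norm w = N" for v w
    by (rule second_difference_eq[OF r(2) d(1) d(2)[folded that] f fd]) (auto simp: F_def that)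
  obtain p where p: "dist p u \<le> d * N"
    "f (u + d *\<^sub>R v + d *\<^sub>R w) - f (u + d *\<^sub>R v) - f (u + d *\<^sub>R w) + f u = d * (d * F v w p)"
    using diff[of v w] by (auto simp: N_def)
  obtain q where q: "dist q u \<le> d * N"
    "f (u + d *\<^sub>R w + d *\<^sub>R v) - f (u + d *\<^sub>R w) - f (u + d *\<^sub>R v) + f u = d * (d * F w v q)"
    using diff[of w v] by (auto simp: N_def add.commute)
  have "u + d *\<^sub>R w + d *\<^sub>R v = u + d *\<^sub>R v + d *\<^sub>R w"
    by (simp add: algebra_simps)
  then have "d * (d * F v w p) = d * (d * F w v q)"
    unfolding p(2)[symmetric] q(2)[symmetric] by (simp add: add_ac)
  then have "F v w p = F w v q"
    using d(1) by simp
  moreover have "dist (F v w p) (F v w u) < e" "dist (F w v q) (F w v u) < e"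
    using p(1) q(1) d(2) r(3,4) r1(2) r2(2) by auto
  ultimately have "dist (F v w u) (F w v u) < e + e"
    by (simp add: dist_real_def)
  then show False
    by (simp add: e_def)
qed

section \<open>Elementary calculus of C^k and smooth maps\<close>

lemma Ck_on_cong:
  assumes "open S" "\<And>p. p \<in> S \<Longrightarrow> f p = g p"
  shows "Ck_on k S f \<longleftrightarrow> Ck_on k S g"
  using assms(2)
proof (induction k arbitrary: f g)
  case 0
  then show ?case
    by (auto cong: continuous_on_cong)
next
  case (Suc k)
  \<comment> \<open>Openness of \<open>S\<close> makes the two-sided derivative at \<open>u\<close>
    depend only on values in \<open>S\<close>.\<close>
  have d: "(f has_derivative D) (at u) \<longleftrightarrow> (g has_derivative D) (at u)" if "u \<in> S" for u D
    using has_derivative_transform_within_open[OF _ assms(1) that] Suc.prems by metis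
  then have "frechet_derivative f (at u) = frechet_derivative g (at u)" if "u \<in> S" for u
    using that by (simp add: frechet_derivative_def)
  then have "Ck_on k S (\<lambda>u. frechet_derivative f (at u) v) \<longleftrightarrow>
      Ck_on k S (\<lambda>u. frechet_derivative g (at u) v)" for v
    by (intro Suc.IH) simp
  moreover have "f differentiable (at u) \<longleftrightarrow> g differentiable (at u)" if "u \<in> S" for u
    using d[OF that] by (simp add: differentiable_def)
  ultimately show ?case
    by simp
qed

lemma frechet_derivative_linear_compose:
  assumes "bounded_linear L" "f differentiable (at u)"
  shows "frechet_derivative (\<lambda>p. L (f p)) (at u) v = L (frechet_derivative f (at u) v)"
proof -
  have "((\<lambda>p. L (f p)) has_derivative (\<lambda>v. L (frechet_derivative f (at u) v))) (at u)"
    using bounded_linear.has_derivative[OF assms(1)] assms(2) frechet_derivative_works by blast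
  from fun_cong[OF frechet_derivative_at[OF this], of v] show ?thesis
    by simp
qed

text \<open>A bounded linear map commutes with directional derivatives, so the induction hypothesis
  applies to each derivative of \<open>f\<close>.\<close>

lemma Ck_on_linear_compose:
  assumes "open S" "bounded_linear L"
  shows "Ck_on k S f \<Longrightarrow> Ck_on k S (\<lambda>p. L (f p))"
proof (induction k arbitrary: f)
  case 0
  then show ?case
    using bounded_linear.continuous_on[OF assms(2)] by auto
next
  case (Suc k)
  have "(\<lambda>p. L (f p)) differentiable (at u)" if "u \<in> S" for u
    using Suc.prems that bounded_linear.has_derivative[OF assms(2)]
    unfolding Ck_on.simps differentiable_def by blast
  moreover have "Ck_on k S (\<lambda>u. frechet_derivative (\<lambda>p. L (f p)) (at u) v)" for v
  proof -
    have "Ck_on k S (\<lambda>u. L (frechet_derivative f (at u) v))"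
      using Suc by simp
    moreover have "frechet_derivative (\<lambda>p. L (f p)) (at u) v = L (frechet_derivative f (at u) v)" if "u \<in> S" for u
      using frechet_derivative_linear_compose[OF assms(2)] Suc.prems that by auto
    ultimately show ?thesis
      by (rule iffD2[OF Ck_on_cong[OF assms(1)], rotated])
  qed
  ultimately show ?case
    by simp
qed

lemma smooth_on_linear_compose:
  "open S \<Longrightarrow> bounded_linear L \<Longrightarrow> smooth_on S f \<Longrightarrow> smooth_on S (\<lambda>p. L (f p))"
  by (simp add: smooth_on_def Ck_on_linear_compose)

lemma smooth_on_const: "smooth_on S (\<lambda>_. c)"
proof -
  have "Ck_on k S (\<lambda>_. c)" for k and c :: 'b
    by (induction k arbitrary: c) auto
  then show ?thesis
    by (simp add: smooth_on_def)
qed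

lemma smooth_on_imp_differentiable: "smooth_on S f \<Longrightarrow> u \<in> S \<Longrightarrow> f differentiable (at u)"
  using Ck_on.simps(2)[of 0 S f] unfolding smooth_on_def by blast

lemma smooth_on_frechet_derivative:
  "smooth_on S f \<Longrightarrow> smooth_on S (\<lambda>u. frechet_derivative f (at u) v)"
  using Ck_on.simps(2)[of _ S f] unfolding smooth_on_def by blast

text \<open>Pairing with a fixed vector \<open>b\<close> commutes with differentiation and reduces
  to the real-valued case; a vector is determined by its inner products.\<close>

lemma symmetric_second_derivative:
  fixes f :: "'a::real_normed_vector \<Rightarrow> 'b::real_inner"
  assumes S: "open S" "u \<in> S" and f: "smooth_on S f"
  shows "frechet_derivative (\<lambda>p. frechet_derivative f (at p) v) (at u) w
       = frechet_derivative (\<lambda>p. frechet_derivative f (at p) w) (at u) v"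
proof -
  have "frechet_derivative (\<lambda>p. frechet_derivative f (at p) v) (at u) w \<bullet> b
      = frechet_derivative (\<lambda>p. frechet_derivative f (at p) w) (at u) v \<bullet> b" for b
  proof -
    let ?g = "\<lambda>p. f p \<bullet> b"
    have L: "bounded_linear (\<lambda>x::'b. x \<bullet> b)"
      by (rule bounded_linear_inner_left)
    have g: "smooth_on S ?g"
      using smooth_on_linear_compose[OF S(1) L f] .
    note g' = smooth_on_frechet_derivative[OF g]
    have "Ck_on 0 S (\<lambda>p. frechet_derivative (\<lambda>p. frechet_derivative ?g (at p) v) (at p) w)" for v w
      using smooth_on_frechet_derivative[OF g'] unfolding smooth_on_def by blast
    then have c: "continuous_on S (\<lambda>p. frechet_derivative (\<lambda>p. frechet_derivative ?g (at p) v) (at p) w)" for v w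
      by simp
    have eq: "frechet_derivative (\<lambda>p. frechet_derivative ?g (at p) v) (at u) w
        = frechet_derivative (\<lambda>p. frechet_derivative f (at p) v) (at u) w \<bullet> b" for v w
    proof -
      have "frechet_derivative (\<lambda>p. frechet_derivative ?g (at p) v) (at u)
          = frechet_derivative (\<lambda>p. frechet_derivative f (at p) v \<bullet> b) (at u)"
        using smooth_on_imp_differentiable[OF smooth_on_frechet_derivative[OF g] S(2)]
          frechet_derivative_linear_compose[OF L smooth_on_imp_differentiable[OF f]]
        by (intro frechet_derivative_transform_within_open[OF _ S]) auto
      then show ?thesis
        using frechet_derivative_linear_compose[OF L smooth_on_imp_differentiable[OF
            smooth_on_frechet_derivative[OF f] S(2)]] by simp
    qed
    show ?thesis
      using symmetric_second_derivative_real[OF S smooth_on_imp_differentiable[OF g]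
          smooth_on_imp_differentiable[OF g'] c] unfolding eq by simp
  qed
  then show ?thesis
    using vector_eq_rdot by blast
qed

section \<open>Normality and \<open>h\<close> under coordinate changes\<close>

lemma bounded_bilinear_matrix_vector_mult:
  "bounded_bilinear ((*v) :: real^'n^'m \<Rightarrow> real^'n \<Rightarrow> real^'m)"
  unfolding bilinear_conv_bounded_bilinear[symmetric] bilinear_def
  by (auto intro!: linearI simp: matrix_vector_mult_add_rdistrib matrix_vector_right_distrib
      matrix_vector_mult_scaleR scaleR_matrix_vector_assoc)

lemmas has_derivative_matrix_vector_mult =
  bounded_bilinear.FDERIV[OF bounded_bilinear_matrix_vector_mult]

text \<open>The device by which identities valid on an open set are differentiated: transformation
  laws, the constraint on the coefficients, and the coordinate expressions of the structure
  tensors.\<close>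

lemma has_derivative_eq_on_open:
  assumes "open S" "u \<in> S" "\<And>p. p \<in> S \<Longrightarrow> f p = g p"
    and "(f has_derivative f') (at u)" "(g has_derivative g') (at u)"
  shows "f' v = g' v"
  using has_derivative_unique[OF has_derivative_transform_within_open[OF assms(4,1,2,3)] assms(5)]
  by simp

section \<open>Product rules and pointwise formulas for the torsion, the exterior derivative and
  \<open>h\<close>\<close>

lemma frechet_derivative_matrix_vector_mult:
  fixes A :: "'a::real_normed_vector \<Rightarrow> real^'n^'m"
  assumes "A differentiable (at u)" "X differentiable (at u)"
  shows "frechet_derivative (\<lambda>p. A p *v X p) (at u) v
    = A u *v frechet_derivative X (at u) v + frechet_derivative A (at u) v *v X u"
proof -
  have "((\<lambda>p. A p *v X p) has_derivative (\<lambda>v. A u *v frechet_derivative X (at u) v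
      + frechet_derivative A (at u) v *v X u)) (at u)"
    using assms unfolding frechet_derivative_works by (rule has_derivative_matrix_vector_mult)
  from fun_cong[OF frechet_derivative_at[OF this], of v] show ?thesis
    by simp
qed

lemma frechet_derivative_inner:
  assumes "\<eta> differentiable (at u)" "X differentiable (at u)"
  shows "frechet_derivative (\<lambda>p. \<eta> p \<bullet> X p) (at u) v
    = \<eta> u \<bullet> frechet_derivative X (at u) v + frechet_derivative \<eta> (at u) v \<bullet> X u"
proof -
  have "((\<lambda>p. \<eta> p \<bullet> X p) has_derivative (\<lambda>v. \<eta> u \<bullet> frechet_derivative X (at u) v
      + frechet_derivative \<eta> (at u) v \<bullet> X u)) (at u)"
    using assms unfolding frechet_derivative_works by (rule has_derivative_inner)
  from fun_cong[OF frechet_derivative_at[OF this], of v] show ?thesis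
    by simp
qed

lemma frechet_derivative_app:
  assumes "\<phi> differentiable (at u)" "X differentiable (at u)"
  shows "frechet_derivative (app \<phi> X) (at u) v
    = \<phi> u *v frechet_derivative X (at u) v + frechet_derivative \<phi> (at u) v *v X u"
  using frechet_derivative_matrix_vector_mult[OF assms] unfolding app_def[abs_def] .

text \<open>After the product rule, the terms of \<open>\<phi>\<close> applied twice to
  \<open>lie_bracket X Y\<close> cancel against those in the mixed brackets, and the other
  derivatives of \<open>X\<close> and \<open>Y\<close> cancel between
  \<open>lie_bracket (app \<phi> X) (app \<phi> Y)\<close> and the mixed brackets.\<close>

lemma nijenhuis_pointwise:
  assumes "\<phi> differentiable (at u)" "X differentiable (at u)" "Y differentiable (at u)"
  shows "nijenhuis \<phi> X Y u =
    frechet_derivative \<phi> (at u) (\<phi> u *v X u) *v Y u - frechet_derivative \<phi> (at u) (\<phi> u *v Y u) *v X u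
    + \<phi> u *v (frechet_derivative \<phi> (at u) (Y u) *v X u) - \<phi> u *v (frechet_derivative \<phi> (at u) (X u) *v Y u)"
  unfolding nijenhuis_def lie_bracket_def
  by (simp add: frechet_derivative_app assms)
    (simp add: app_def lie_bracket_def frechet_derivative_app assms matrix_vector_mult_diff_distrib
      matrix_vector_right_distrib)

lemma ext_deriv_pointwise:
  assumes "\<eta> differentiable (at u)" "X differentiable (at u)" "Y differentiable (at u)"
  shows "ext_deriv \<eta> X Y u =
    (1/2) * (frechet_derivative \<eta> (at u) (X u) \<bullet> Y u - frechet_derivative \<eta> (at u) (Y u) \<bullet> X u)"
  unfolding ext_deriv_def deriv_along_def lie_bracket_def
  by (simp add: frechet_derivative_inner assms inner_diff_right)

text \<open>The value of \<open>[\<phi>, \<phi>] - 2 d\<eta> \<otimes> \<xi>\<close> on tangent vectors: in the Nijenhuis torsion all derivatives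
  of the vector fields cancel.\<close>

definition normality_defect :: "tensor3 \<Rightarrow> field3 \<Rightarrow> field3 \<Rightarrow> real^3 \<Rightarrow> real^3 \<Rightarrow> real^3 \<Rightarrow> real^3" where
  "normality_defect \<phi> \<xi> \<eta> u v w =
    frechet_derivative \<phi> (at u) (\<phi> u *v v) *v w - frechet_derivative \<phi> (at u) (\<phi> u *v w) *v v
    + \<phi> u *v (frechet_derivative \<phi> (at u) w *v v) - \<phi> u *v (frechet_derivative \<phi> (at u) v *v w)
    - (frechet_derivative \<eta> (at u) v \<bullet> w - frechet_derivative \<eta> (at u) w \<bullet> v) *\<^sub>R \<xi> u"

text \<open>Any two tangent vectors are the values of constant fields, which are smooth; this turns
  the quantification over fields into one over vectors.\<close>

lemma normal_on_iff_normality_defect: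
  assumes "smooth_on S \<phi>" "smooth_on S \<eta>"
  shows "normal_on S \<phi> \<xi> \<eta> \<longleftrightarrow> (\<forall>u\<in>S. \<forall>v w. normality_defect \<phi> \<xi> \<eta> u v w = 0)"
proof -
  have "nijenhuis \<phi> X Y u - (2 * ext_deriv \<eta> X Y u) *\<^sub>R \<xi> u = normality_defect \<phi> \<xi> \<eta> u (X u) (Y u)"
    if "smooth_on S X" "smooth_on S Y" "u \<in> S" for X Y u
    using assms that by (simp add: normality_defect_def nijenhuis_pointwise ext_deriv_pointwise
        smooth_on_imp_differentiable[of S])
  then show ?thesis
    unfolding normal_on_def using smooth_on_const by (metis (no_types, lifting))
qed

lemma h_tensor_mult:
  assumes "\<phi> differentiable (at u)" "\<xi> differentiable (at u)"
  shows "h_tensor \<phi> \<xi> u *v v = (1/2) *\<^sub>R (frechet_derivative \<phi> (at u) (\<xi> u) *v v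
    - frechet_derivative \<xi> (at u) (\<phi> u *v v) + \<phi> u *v frechet_derivative \<xi> (at u) v)"
proof -
  let ?L = "\<lambda>v. (1/2) *\<^sub>R (frechet_derivative \<phi> (at u) (\<xi> u) *v v
    - frechet_derivative \<xi> (at u) (\<phi> u *v v) + \<phi> u *v frechet_derivative \<xi> (at u) v)"
  have eq: "(\<lambda>v. (1/2) *\<^sub>R lie_deriv \<xi> \<phi> (\<lambda>_. v) u) = ?L"
    using assms by (auto simp: lie_deriv_def lie_bracket_def frechet_derivative_app app_def
        linear_neg[OF matrix_vector_mul_linear])
  note D = linear_frechet_derivative[OF assms(2)]
  \<comment> \<open>Multiplication by \<open>matrix ?L\<close> returns \<open>?L\<close> because
    \<open>?L\<close> is linear.\<close>
  have "linear ?L"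
    by (rule linearI)
      (simp_all add: matrix_vector_right_distrib linear_add[OF D] linear_cmul[OF D]
        matrix_vector_mult_scaleR algebra_simps flip: scaleR_matrix_vector_assoc)
  then show ?thesis
    unfolding h_tensor_def eq by simp
qed

text \<open>\<open>K v\<close> is the derivative of the Jacobian matrix \<open>J\<close> in direction \<open>v\<close>, so \<open>K v *v w\<close> is the second
  derivative of the coordinate change.\<close>

locale coordinate_change =
  fixes S :: "(real^3) set" and u :: "real^3" and T :: field3 and J :: tensor3
    and K :: "real^3 \<Rightarrow> real^3^3"
  assumes S: "open S" "u \<in> S"
    and T: "(T has_derivative (*v) (J u)) (at u)"
    and J: "(J has_derivative K) (at u)"
    and K_sym: "K v *v w = K w *v v"
begin

text \<open>The transformation law, applied to a fixed vector \<open>w\<close>, is differentiated at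
  \<open>u\<close> in direction \<open>v\<close> and solved for the derivative of
  \<open>\<phi>'\<close>. The \<open>K\<close> terms are the non-tensorial part; the next two lemmas
  do the same for vector fields and 1-forms.\<close>

lemma tensor_derivative:
  assumes "\<phi>' differentiable (at (T u))" "\<phi> differentiable (at u)"
    and eq: "\<And>p. p \<in> S \<Longrightarrow> \<phi>' (T p) ** J p = J p ** \<phi> p"
  shows "frechet_derivative \<phi>' (at (T u)) (J u *v v) *v (J u *v w)
    = K v *v (\<phi> u *v w) + J u *v (frechet_derivative \<phi> (at u) v *v w) - \<phi>' (T u) *v (K v *v w)"
proof -
  let ?D = "frechet_derivative \<phi> (at u)" and ?D' = "frechet_derivative \<phi>' (at (T u))"
  have w: "((\<lambda>_. w) has_derivative (\<lambda>_. 0)) (at u)"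
    by simp
  have R: "((\<lambda>p. J p *v (\<phi> p *v w)) has_derivative (\<lambda>v. J u *v (\<phi> u *v 0 + ?D v *v w) + K v *v (\<phi> u *v w))) (at u)"
    using assms(2) unfolding frechet_derivative_works
    by (intro has_derivative_matrix_vector_mult J w)
  have L: "((\<lambda>p. \<phi>' (T p) *v (J p *v w)) has_derivative
      (\<lambda>v. \<phi>' (T u) *v (J u *v 0 + K v *v w) + ?D' (J u *v v) *v (J u *v w))) (at u)"
    using assms(1) unfolding frechet_derivative_works
    by (intro has_derivative_matrix_vector_mult J w has_derivative_compose[OF T])
  have LR: "\<phi>' (T p) *v (J p *v w) = J p *v (\<phi> p *v w)" if "p \<in> S" for p
    using eq[OF that] by (simp add: matrix_vector_mul_assoc)
  show ?thesis
    using has_derivative_eq_on_open[OF S LR L R, of v] by (simp add: algebra_simps)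
qed

lemma vector_derivative:
  assumes "\<xi>' differentiable (at (T u))" "\<xi> differentiable (at u)"
    and eq: "\<And>p. p \<in> S \<Longrightarrow> \<xi>' (T p) = J p *v \<xi> p"
  shows "frechet_derivative \<xi>' (at (T u)) (J u *v v)
    = K v *v \<xi> u + J u *v frechet_derivative \<xi> (at u) v"
proof -
  have R: "((\<lambda>p. J p *v \<xi> p) has_derivative
      (\<lambda>v. J u *v frechet_derivative \<xi> (at u) v + K v *v \<xi> u)) (at u)"
    using assms(2) unfolding frechet_derivative_works
    by (intro has_derivative_matrix_vector_mult J)
  have L: "((\<lambda>p. \<xi>' (T p)) has_derivative
      (\<lambda>v. frechet_derivative \<xi>' (at (T u)) (J u *v v))) (at u)"
    using assms(1) unfolding frechet_derivative_works by (rule has_derivative_compose[OF T])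
  show ?thesis
    using has_derivative_eq_on_open[OF S eq L R, of v] by (simp add: add.commute)
qed

lemma one_form_derivative:
  assumes "\<eta>' differentiable (at (T u))" "\<eta> differentiable (at u)"
    and eq: "\<And>p. p \<in> S \<Longrightarrow> \<eta> p = \<eta>' (T p) v* J p"
  shows "frechet_derivative \<eta> (at u) v \<bullet> w
    = frechet_derivative \<eta>' (at (T u)) (J u *v v) \<bullet> (J u *v w) + \<eta>' (T u) \<bullet> (K v *v w)"
proof -
  let ?D = "frechet_derivative \<eta> (at u)" and ?D' = "frechet_derivative \<eta>' (at (T u))"
  have w: "((\<lambda>_. w) has_derivative (\<lambda>_. 0)) (at u)"
    by simp
  have L: "((\<lambda>p. \<eta> p \<bullet> w) has_derivative (\<lambda>v. \<eta> u \<bullet> 0 + ?D v \<bullet> w)) (at u)"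
    using assms(2) unfolding frechet_derivative_works
    by (intro has_derivative_inner w)
  have R: "((\<lambda>p. \<eta>' (T p) \<bullet> (J p *v w)) has_derivative
      (\<lambda>v. \<eta>' (T u) \<bullet> (J u *v 0 + K v *v w) + ?D' (J u *v v) \<bullet> (J u *v w))) (at u)"
    using assms(1) unfolding frechet_derivative_works
    by (intro has_derivative_matrix_vector_mult has_derivative_inner J w has_derivative_compose[OF T])
  have LR: "\<eta> p \<bullet> w = \<eta>' (T p) \<bullet> (J p *v w)" if "p \<in> S" for p
    using eq[OF that] by (simp add: dot_lmul_matrix)
  show ?thesis
    using has_derivative_eq_on_open[OF S LR L R, of v] by simp
qed

text \<open>The second derivatives of the coordinate change cancel in pairs by the symmetry of
  \<open>K\<close>, those from the torsion and those from the exterior derivative of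
  \<open>\<eta>\<close> separately.\<close>

lemma normality_defect_transform:
  assumes "\<phi>' differentiable (at (T u))" "\<phi> differentiable (at u)"
    and "\<eta>' differentiable (at (T u))" "\<eta> differentiable (at u)"
    and \<phi>: "\<And>p. p \<in> S \<Longrightarrow> \<phi>' (T p) ** J p = J p ** \<phi> p"
    and \<xi>: "\<And>p. p \<in> S \<Longrightarrow> \<xi>' (T p) = J p *v \<xi> p"
    and \<eta>: "\<And>p. p \<in> S \<Longrightarrow> \<eta> p = \<eta>' (T p) v* J p"
  shows "normality_defect \<phi>' \<xi>' \<eta>' (T u) (J u *v v) (J u *v w) = J u *v normality_defect \<phi> \<xi> \<eta> u v w"
proof -
  have \<phi>J: "\<phi>' (T u) *v (J u *v v) = J u *v (\<phi> u *v v)" for v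
    using \<phi>[OF S(2)] by (simp add: matrix_vector_mul_assoc)
  note D = tensor_derivative[OF assms(1,2) \<phi>] one_form_derivative[OF assms(3,4) \<eta>]
  show ?thesis
    unfolding normality_defect_def \<phi>J \<xi>[OF S(2)]
    \<comment> \<open>These are the pairs of arguments at which \<open>K\<close> occurs:
      \<open>v\<close> or its image under \<open>\<phi>\<close>, and \<open>w\<close> or its
      image.\<close>
    using K_sym[of v w] K_sym[of "\<phi> u *v v" w] K_sym[of v "\<phi> u *v w"] K_sym[of "\<phi> u *v v" "\<phi> u *v w"]
    by (simp add: D matrix_vector_right_distrib matrix_vector_mult_diff_distrib matrix_vector_mult_scaleR \<phi>J)
qed

text \<open>Again the \<open>K\<close> terms cancel by symmetry: those from the derivative of
  \<open>\<phi>'\<close> along \<open>\<xi>'\<close> against those from the derivative of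
  \<open>\<xi>'\<close>.\<close>

lemma h_tensor_transform:
  assumes "\<phi>' differentiable (at (T u))" "\<phi> differentiable (at u)"
    and "\<xi>' differentiable (at (T u))" "\<xi> differentiable (at u)"
    and \<phi>: "\<And>p. p \<in> S \<Longrightarrow> \<phi>' (T p) ** J p = J p ** \<phi> p"
    and \<xi>: "\<And>p. p \<in> S \<Longrightarrow> \<xi>' (T p) = J p *v \<xi> p"
  shows "h_tensor \<phi>' \<xi>' (T u) ** J u = J u ** h_tensor \<phi> \<xi> u"
proof -
  have \<phi>J: "\<phi>' (T u) *v (J u *v v) = J u *v (\<phi> u *v v)" for v
    using \<phi>[OF S(2)] by (simp add: matrix_vector_mul_assoc)
  note D = tensor_derivative[OF assms(1,2) \<phi>] vector_derivative[OF assms(3,4) \<xi>]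
  have "h_tensor \<phi>' \<xi>' (T u) *v (J u *v v) = J u *v (h_tensor \<phi> \<xi> u *v v)" for v
    unfolding h_tensor_mult[OF assms(1,3)] h_tensor_mult[OF assms(2,4)] \<xi>[OF S(2)] \<phi>J
    using K_sym[of "\<xi> u" v] K_sym[of "\<xi> u" "\<phi> u *v v"]
    by (simp add: D matrix_vector_right_distrib matrix_vector_mult_diff_distrib matrix_vector_mult_scaleR \<phi>J)
  then show ?thesis
    by (simp add: matrix_eq flip: matrix_vector_mul_assoc)
qed

end

text \<open>\<open>K\<close> is the derivative of the Jacobian matrix; it acts as the second
  derivative of \<open>T\<close>, so its symmetry is that of second derivatives.\<close>

lemma coordinate_change_smooth:
  assumes S: "open S" "u \<in> S" and T: "smooth_on S T"
  obtains K where "coordinate_change S u T (\<lambda>p. matrix (frechet_derivative T (at p))) K"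
proof -
  define J where "J = (\<lambda>p. matrix (frechet_derivative T (at p)))"
  have Jw: "J p *v w = frechet_derivative T (at p) w" if "p \<in> S" for p w
    using linear_frechet_derivative[OF smooth_on_imp_differentiable[OF T that]]
    by (simp add: J_def)
  have d: "(\<lambda>p. frechet_derivative T (at p) w) differentiable (at u)" for w
    using smooth_on_imp_differentiable[OF smooth_on_frechet_derivative[OF T] S(2)] .
  \<comment> \<open>The matrices \<open>axis i (axis j 1)\<close> form the standard basis, so this
    is differentiability of the entries.\<close>
  have "(\<lambda>p. J p \<bullet> axis i (axis j 1)) differentiable (at u)" for i j
  proof -
    have "(\<lambda>p. frechet_derivative T (at p) (axis j 1) \<bullet> axis i 1) differentiable (at u)"
      using d by (auto intro!: differentiable_inner)
    then show ?thesis
      by (simp add: J_def matrix_def inner_axis)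
  qed
  then have "J differentiable (at u)"
    unfolding differentiable_componentwise_within[of J] by (auto simp: Basis_vec_def)
  then obtain K where K: "(J has_derivative K) (at u)"
    unfolding differentiable_def by blast
  have KD: "K v *v w = frechet_derivative (\<lambda>p. frechet_derivative T (at p) w) (at u) v" for v w
  proof -
    have "((\<lambda>p. J p *v w) has_derivative (\<lambda>v. J u *v 0 + K v *v w)) (at u)"
      by (intro has_derivative_matrix_vector_mult K) simp
    then have "((\<lambda>p. frechet_derivative T (at p) w) has_derivative (\<lambda>v. J u *v 0 + K v *v w)) (at u)"
      by (rule has_derivative_transform_within_open[OF _ S]) (rule Jw)
    from fun_cong[OF frechet_derivative_at[OF this], of v] show ?thesis
      by simp
  qed
  have "(T has_derivative frechet_derivative T (at u)) (at u)"
    using smooth_on_imp_differentiable[OF T S(2)] frechet_derivative_works by blast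
  moreover have "frechet_derivative T (at u) = (*v) (J u)"
    using Jw[OF S(2)] by auto
  ultimately have "coordinate_change S u T J K"
    using S K symmetric_second_derivative[OF S T] by unfold_locales (auto simp: KD)
  then show ?thesis
    using that unfolding J_def by blast
qed

section \<open>Darboux coordinates on an open set\<close>

lemma linear_real3_expand:
  fixes f :: "real^3 \<Rightarrow> real"
  assumes "linear f"
  shows "f w = w$1 * f (axis 1 1) + w$2 * f (axis 2 1) + w$3 * f (axis 3 1)"
proof -
  have "w = w$1 *\<^sub>R axis 1 1 + w$2 *\<^sub>R axis 2 1 + w$3 *\<^sub>R axis 3 1"
    by (simp add: vec_eq_iff forall_3 axis_def)
  then have "f w = f (w$1 *\<^sub>R axis 1 1 + w$2 *\<^sub>R axis 2 1 + w$3 *\<^sub>R axis 3 1)"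
    by simp
  also have "\<dots> = w$1 * f (axis 1 1) + w$2 * f (axis 2 1) + w$3 * f (axis 3 1)"
    by (simp add: linear_add[OF assms] linear_cmul[OF assms])
  finally show ?thesis .
qed

lemma axis_real3_nth:
  "(axis 1 1 :: real^3) $ 1 = 1" "(axis 1 1 :: real^3) $ 2 = 0" "(axis 1 1 :: real^3) $ 3 = 0"
  "(axis 2 1 :: real^3) $ 1 = 0" "(axis 2 1 :: real^3) $ 2 = 1" "(axis 2 1 :: real^3) $ 3 = 0"
  "(axis 3 1 :: real^3) $ 1 = 0" "(axis 3 1 :: real^3) $ 2 = 0" "(axis 3 1 :: real^3) $ 3 = 1"
  by (simp_all add: axis_def)

lemma matrix_vector_mult_real3_nth:
  fixes A :: "real^3^3"
  shows "(A *v v) $ i = A$i$1 * v$1 + A$i$2 * v$2 + A$i$3 * v$3"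
  by (simp add: matrix_vector_mult_def sum_3)

text \<open>In one direction, short vertical segments at \<open>u\<close> lie in a ball inside
  \<open>S\<close>, so \<open>f\<close> is locally constant along the vertical line. In the other,
  \<open>f\<close> has zero derivative along the given segment.\<close>

lemma indep_of_z_iff_partial_z:
  assumes S: "open S" and f: "\<And>p. p \<in> S \<Longrightarrow> f differentiable (at p)"
  shows "indep_of_z S f \<longleftrightarrow> (\<forall>u\<in>S. partial_z f u = 0)"
proof
  assume ind: "indep_of_z S f"
  show "\<forall>u\<in>S. partial_z f u = 0"
  proof
    fix u assume u: "u \<in> S"
    obtain r where r: "r > 0" "ball u r \<subseteq> S"
      using S u openE by blast
    have const: "f (u + t *\<^sub>R axis 3 1) = f u" if "t \<in> ball 0 r" for t
    proof -
      have "closed_segment u (u + t *\<^sub>R axis 3 1) \<subseteq> ball u r"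
        using that r(1) by (intro closed_segment_subset) (auto simp: dist_norm)
      with r(2) ind show ?thesis
        by (auto simp: indep_of_z_def)
    qed
    have d: "((\<lambda>s. f (u + s *\<^sub>R axis 3 1)) has_derivative
        (\<lambda>h. h *\<^sub>R frechet_derivative f (at (u + 0 *\<^sub>R axis 3 1)) (axis 3 1))) (at 0)"
      using f u by (intro has_derivative_along_line) simp
    have "(1::real) *\<^sub>R frechet_derivative f (at (u + 0 *\<^sub>R axis 3 1)) (axis 3 1) = 0"
      using r(1) by (intro has_derivative_eq_on_open[OF open_ball[of 0 r] _ const d has_derivative_const, where v = 1]) auto
    then show "partial_z f u = 0"
      by (simp add: partial_z_def)
  qed
next
  assume z: "\<forall>u\<in>S. partial_z f u = 0"
  show "indep_of_z S f"
    unfolding indep_of_z_def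
  proof (intro allI impI)
    fix u :: "real^3" and t assume seg: "closed_segment u (u + t *\<^sub>R axis 3 1) \<subseteq> S"
    \<comment> \<open>Parametrizing the segment over \<open>{0..1}\<close> treats both signs of
      \<open>t\<close> at once.\<close>
    have "((\<lambda>s. f (u + s *\<^sub>R (t *\<^sub>R axis 3 1))) has_derivative (\<lambda>h. 0)) (at s within {0..1})"
      if s: "s \<in> {0..1}" for s
    proof -
      have "u + s *\<^sub>R (t *\<^sub>R axis 3 1) \<in> closed_segment u (u + t *\<^sub>R axis 3 1)"
        using s unfolding in_segment by (intro exI[of _ s]) (simp add: algebra_simps)
      then have p: "u + s *\<^sub>R (t *\<^sub>R axis 3 1) \<in> S"
        using seg by blast
      have "frechet_derivative f (at (u + s *\<^sub>R (t *\<^sub>R axis 3 1))) (t *\<^sub>R axis 3 1) = 0"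
        using z p linear_cmul[OF linear_frechet_derivative[OF f[OF p]]] by (auto simp: partial_z_def)
      then show ?thesis
        using has_derivative_at_withinI[OF has_derivative_along_line[OF f[OF p]]] by simp
    qed
    then show "f (u + t *\<^sub>R axis 3 1) = f u"
      using has_derivative_zero_unique[of "{0..1::real}" "\<lambda>s. f (u + s *\<^sub>R (t *\<^sub>R axis 3 1))" 1 0] by simp
  qed
qed

text \<open>Linear algebra at one point: \<open>P\<close>, \<open>G\<close>, \<open>x\<close>,
  \<open>e\<close> are the values of \<open>\<phi>\<close>, \<open>g\<close>, \<open>\<xi>\<close>,
  \<open>\<eta>\<close> there, \<open>y\<close> is the second coordinate, and the right-hand side of
  \<open>contact\<close> is the exterior derivative of \<open>\<eta>\<close> in Darboux
  coordinates.\<close>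

lemma darboux_normal_form_at:
  fixes P G :: "real^3^3" and x :: "real^3" and y :: real
  defines "e \<equiv> (1/2) *\<^sub>R (axis 3 1 - y *\<^sub>R axis 1 1)"
  assumes sym: "transpose G = G"
    and Px: "P *v x = 0" and eP: "\<And>v. e \<bullet> (P *v v) = 0" and ex: "e \<bullet> x = 1"
    and PP: "\<And>v. P *v (P *v v) = v - (e \<bullet> v) *\<^sub>R x"
    and compat: "\<And>v w. (P *v v) \<bullet> (G *v (P *v w)) = - (v \<bullet> (G *v w)) + (e \<bullet> v) * (e \<bullet> w)"
    and contact: "\<And>v w. v \<bullet> (G *v (P *v w)) = (1/4) * (v$1 * w$2 - v$2 * w$1)"
  shows "x = 2 *\<^sub>R axis 3 1"
    and "G = (1/4) *\<^sub>R vector [vector [4 * G$1$1, 4 * G$1$2, - y], vector [4 * G$1$2, 4 * G$2$2, 0],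
      vector [- y, 0, 1]]" (is "G = ?G")
    and "P = vector [vector [- (4 * G$1$2), - (4 * G$2$2), 0], vector [4 * G$1$1 - y\<^sup>2, 4 * G$1$2, 0],
      vector [- (4 * G$1$2 * y), - (4 * G$2$2 * y), 0]]" (is "P = ?P")
    and "4 * G$1$1 * (4 * G$2$2) - (4 * G$1$2)\<^sup>2 - 4 * G$2$2 * y\<^sup>2 = - 1"
proof -
  have e: "e \<bullet> v = (v$3 - y * v$1) / 2" for v
    by (simp add: e_def inner_diff_left inner_axis')
  have col: "(A *v axis j 1) $ i = A$i$j" for A :: "real^3^3" and i j
    by (simp add: matrix_vector_mult_basis column_def)
  note ax = axis_real3_nth
  \<comment> \<open>As \<open>P\<close> kills \<open>x\<close>, the form in \<open>contact\<close>
    vanishes whenever its second argument is \<open>x\<close>.\<close>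
  have x12: "x$1 = 0" "x$2 = 0"
    using contact[of "axis 1 1" x] contact[of "axis 2 1" x] by (auto simp: Px ax)
  then have x3: "x$3 = 2"
    using ex e by simp
  with x12 show x: "x = 2 *\<^sub>R axis 3 1"
    by (auto simp: vec_eq_iff forall_3 ax)
  have P3: "P$i$3 = 0" for i
    using arg_cong[OF Px, of "\<lambda>z. z$i"] by (simp add: x matrix_vector_mult_scaleR col)
  have P3': "P$3$j = y * P$1$j" for j
    using eP[of "axis j 1"] by (simp add: e col)
  have Gs: "G$i$j = G$j$i" for i j
    using arg_cong[OF sym, of "\<lambda>z. z$i$j"] by (simp add: transpose_def)
  \<comment> \<open>Compatibility with second argument \<open>x\<close> gives
    \<open>G *v x = e\<close>; the factor 2 in \<open>x\<close> causes the halving.\<close>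
  have G3: "G$i$3 = e \<bullet> axis i 1 / 2" for i
  proof -
    have "axis i 1 \<bullet> (G *v x) = (e \<bullet> axis i 1) * (e \<bullet> x)"
      using compat[of "axis i 1" x] unfolding Px by simp
    then show ?thesis
      unfolding ex by (simp add: x matrix_vector_mult_scaleR inner_axis' col)
  qed
  have G3': "G$1$3 = - y / 4" "G$2$3 = 0" "G$3$3 = 1 / 4"
    by (simp_all add: G3 e ax)
  show "G = ?G"
    using G3' Gs[of 3 1] Gs[of 3 2] Gs[of 2 1]
    by (simp add: vec_eq_iff forall_3)
  have PP': "(\<Sum>k\<in>UNIV. P$i$k * P$k$j) = (axis j 1 - (e \<bullet> axis j 1) *\<^sub>R x) $ i" for i j
    using arg_cong[OF PP[of "axis j 1"], of "\<lambda>z. z$i"]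
    by (simp add: matrix_vector_mul_component[of P "P *v _"] inner_vec_def col)
  \<comment> \<open>The upper left block of \<open>P\<close> squares to the identity, since the
    first two components of \<open>x\<close> vanish.\<close>
  have sq: "P$1$1 * P$1$1 + P$1$2 * P$2$1 = 1" "P$1$1 * P$1$2 + P$1$2 * P$2$2 = 0"
    "P$2$1 * P$1$1 + P$2$2 * P$2$1 = 0" "P$2$1 * P$1$2 + P$2$2 * P$2$2 = 1"
    using PP'[of 1 1] PP'[of 1 2] PP'[of 2 1] PP'[of 2 2] by (simp_all add: sum_3 P3 x12 ax)
  have GP: "(\<Sum>k\<in>UNIV. G$i$k * P$k$j) = (1/4) * (axis i 1 $ 1 * axis j 1 $ 2 - axis i 1 $ 2 * axis j 1 $ 1)" for i j
    using contact[of "axis i 1" "axis j 1"] unfolding inner_axis'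
    by (simp add: matrix_vector_mul_component[of G "P *v _"] inner_vec_def col)
  define a b c where abc: "a = 4 * G$1$1" "b = 4 * G$1$2" "c = 4 * G$2$2"
  \<comment> \<open>The upper left block of \<open>contact\<close>. The third row of
    \<open>P\<close> is \<open>y\<close> times the first, which shifts \<open>a\<close> to
    \<open>a - y\<^sup>2\<close>.\<close>
  have gp: "(a - y\<^sup>2) * P$1$1 + b * P$2$1 = 0" "(a - y\<^sup>2) * P$1$2 + b * P$2$2 = 1"
    "b * P$1$1 + c * P$2$1 = - 1" "b * P$1$2 + c * P$2$2 = 0"
    using GP[of 1 1] GP[of 1 2] GP[of 2 1] GP[of 2 2]
    by (simp_all add: sum_3 P3 P3' G3' Gs[of 2 1] ax abc algebra_simps power2_eq_square)
  \<comment> \<open>With \<open>Q\<close> the block of \<open>P\<close>, \<open>gp\<close> reads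
    \<open>M Q = W\<close>, where \<open>W\<close> has rows (0, 1) and (-1, 0). Since
    \<open>Q\<close> is its own inverse, \<open>M = W Q\<close>, which lists the entries of
    \<open>Q\<close>.\<close>
  have P: "P$2$1 = a - y\<^sup>2" "P$2$2 = b" "P$1$1 = - b" "P$1$2 = - c"
    using sq gp by algebra+
  show "P = ?P"
    using P P3 P3' by (simp add: vec_eq_iff forall_3 abc)
  show "4 * G$1$1 * (4 * G$2$2) - (4 * G$1$2)\<^sup>2 - 4 * G$2$2 * y\<^sup>2 = - 1"
    using sq(1) unfolding P abc[symmetric] by algebra
qed

locale darboux =
  fixes S :: "(real^3) set" and \<phi> :: tensor3 and \<xi> \<eta> :: field3 and g :: tensor3
  assumes open_S: "open S" and paracontact: "paracontact_metric_on S \<phi> \<xi> \<eta> g"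
    and \<eta>: "u \<in> S \<Longrightarrow> \<eta> u = (1/2) *\<^sub>R (axis 3 1 - u$2 *\<^sub>R axis 1 1)"
begin

section \<open>The coefficient functions and the normal form at all points\<close>

definition a where "a u = 4 * g u $ 1 $ 1"
definition b where "b u = 4 * g u $ 1 $ 2"
definition c where "c u = 4 * g u $ 2 $ 2"

lemma smooth: "smooth_on S \<phi>" "smooth_on S \<xi>" "smooth_on S \<eta>" "smooth_on S g"
  using paracontact
  by (auto simp: paracontact_metric_on_def almost_paracontact_on_def pseudo_riemannian_on_def)

lemma smooth_abc: "smooth_on S a" "smooth_on S b" "smooth_on S c"
proof -
  have L: "bounded_linear (\<lambda>A::real^3^3. 4 * A$i$j)" for i j
    by (intro bounded_linear_const_mult bounded_linear_vec_nth
        bounded_linear_compose[OF bounded_linear_vec_nth])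
  show "smooth_on S a" "smooth_on S b" "smooth_on S c"
    unfolding a_def[abs_def] b_def[abs_def] c_def[abs_def]
    by (auto intro: smooth_on_linear_compose[OF open_S L smooth(4)])
qed

lemma differentiable:
  assumes "u \<in> S"
  shows "\<phi> differentiable (at u)" "\<xi> differentiable (at u)" "\<eta> differentiable (at u)"
    "a differentiable (at u)" "b differentiable (at u)" "c differentiable (at u)"
  using smooth smooth_abc assms smooth_on_imp_differentiable by blast+

lemma frechet_derivative_eta:
  assumes "u \<in> S"
  shows "frechet_derivative \<eta> (at u) v = - (v$2 / 2) *\<^sub>R axis 1 1"
proof -
  have "((\<lambda>u. (1/2) *\<^sub>R (axis 3 1 - u$2 *\<^sub>R axis 1 1)) has_derivative
      (\<lambda>v. (1/2) *\<^sub>R (0 - v$2 *\<^sub>R axis 1 1 :: real^3))) (at u)"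
    by (intro has_derivative_scaleR_right has_derivative_diff has_derivative_const
        bounded_linear_imp_has_derivative bounded_linear_scaleR_left
        bounded_linear_compose[OF bounded_linear_scaleR_left] bounded_linear_vec_nth)
  moreover have "(\<eta> has_derivative frechet_derivative \<eta> (at u)) (at u)"
    using differentiable[OF assms] frechet_derivative_works by blast
  ultimately have "frechet_derivative \<eta> (at u) v = (1/2) *\<^sub>R (0 - v$2 *\<^sub>R axis 1 1)"
    using \<eta> by (intro has_derivative_eq_on_open[OF open_S assms, of \<eta>])
  then show ?thesis
    by (simp add: scaleR_left_distrib)
qed

lemma normal_form:
  assumes u: "u \<in> S"
  shows "\<xi> u = 2 *\<^sub>R axis 3 1"
    and "g u = (1/4) *\<^sub>R vector [vector [a u, b u, - (u$2)], vector [b u, c u, 0], vector [- (u$2), 0, 1]]"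
    and "\<phi> u = vector [vector [- b u, - c u, 0], vector [a u - (u$2)\<^sup>2, b u, 0],
      vector [- (b u * u$2), - (c u * u$2), 0]]"
    and "a u * c u - (b u)\<^sup>2 - c u * (u$2)\<^sup>2 = - 1"
proof -
  have sym: "transpose (g u) = g u"
    using paracontact u by (auto simp: paracontact_metric_on_def pseudo_riemannian_on_def)
  have ac: "\<phi> u *v \<xi> u = 0" "\<And>v. \<eta> u \<bullet> (\<phi> u *v v) = 0" "\<eta> u \<bullet> \<xi> u = 1"
    "\<And>v. \<phi> u *v (\<phi> u *v v) = v - (\<eta> u \<bullet> v) *\<^sub>R \<xi> u"
    using paracontact u by (auto simp: paracontact_metric_on_def almost_paracontact_on_def)
  have compat: "\<And>v w. (\<phi> u *v v) \<bullet> (g u *v (\<phi> u *v w)) = - (v \<bullet> (g u *v w)) + (\<eta> u \<bullet> v) * (\<eta> u \<bullet> w)"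
    using paracontact u by (auto simp: paracontact_metric_on_def)
  have contact: "v \<bullet> (g u *v (\<phi> u *v w)) = (1/4) * (v$1 * w$2 - v$2 * w$1)" for v w
  proof -
    have "ext_deriv \<eta> (\<lambda>_. v) (\<lambda>_. w) u = v \<bullet> (g u *v (\<phi> u *v w))"
      using paracontact u smooth_on_const[of S v] smooth_on_const[of S w]
      unfolding paracontact_metric_on_def by blast
    then show ?thesis
      using differentiable[OF u] u
      by (simp add: ext_deriv_pointwise frechet_derivative_eta inner_axis' field_simps)
  qed
  note nf = darboux_normal_form_at[OF sym ac[unfolded \<eta>[OF u]] compat[unfolded \<eta>[OF u]] contact]
  show "\<xi> u = 2 *\<^sub>R axis 3 1"
    "g u = (1/4) *\<^sub>R vector [vector [a u, b u, - (u$2)], vector [b u, c u, 0], vector [- (u$2), 0, 1]]"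
    "\<phi> u = vector [vector [- b u, - c u, 0], vector [a u - (u$2)\<^sup>2, b u, 0],
      vector [- (b u * u$2), - (c u * u$2), 0]]"
    "a u * c u - (b u)\<^sup>2 - c u * (u$2)\<^sup>2 = - 1"
    unfolding a_def b_def c_def by (fact nf)+
qed

section \<open>Derivatives of the coefficients and of \<open>\<phi>\<close>\<close>

abbreviation Da where "Da u \<equiv> frechet_derivative a (at u)"
abbreviation Db where "Db u \<equiv> frechet_derivative b (at u)"
abbreviation Dc where "Dc u \<equiv> frechet_derivative c (at u)"

lemma has_derivatives:
  assumes u: "u \<in> S"
  shows "(a has_derivative Da u) (at u)" "(b has_derivative Db u) (at u)" "(c has_derivative Dc u) (at u)"
    "((\<lambda>u. u$2) has_derivative (\<lambda>w. w$2)) (at u)"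
  using differentiable[OF u] frechet_derivative_works
  by (auto intro: bounded_linear_imp_has_derivative bounded_linear_vec_nth)

text \<open>Its cases in the \<open>x\<close> and \<open>y\<close> directions are the relations that
  make the normality defect vanish when nothing depends on \<open>z\<close>.\<close>

lemma constraint_derivative:
  assumes u: "u \<in> S"
  shows "Da u w * c u + a u * Dc u w - 2 * b u * Db u w - Dc u w * (u$2)\<^sup>2 - 2 * c u * u$2 * w$2 = 0"
proof -
  have L: "((\<lambda>u. a u * c u - b u * b u - c u * (u$2 * u$2)) has_derivative
      (\<lambda>w. (a u * Dc u w + Da u w * c u) - (b u * Db u w + Db u w * b u)
        - (c u * (u$2 * w$2 + w$2 * u$2) + Dc u w * (u$2 * u$2)))) (at u)"
    by (intro has_derivative_diff has_derivative_mult has_derivatives[OF u])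
  have eq: "a p * c p - b p * b p - c p * (p$2 * p$2) = - 1" if "p \<in> S" for p
    using normal_form(4)[OF that] by (simp add: power2_eq_square)
  show ?thesis
    using has_derivative_eq_on_open[OF open_S u eq L has_derivative_const, of w]
    by (simp add: algebra_simps power2_eq_square)
qed

lemma frechet_derivative_phi:
  assumes u: "u \<in> S"
  shows "frechet_derivative \<phi> (at u) w = vector [vector [- Db u w, - Dc u w, 0],
    vector [Da u w - 2 * u$2 * w$2, Db u w, 0],
    vector [- (Db u w * u$2 + b u * w$2), - (Dc u w * u$2 + c u * w$2), 0]]"
proof -
  note d = has_derivatives[OF u]
  have L: "((\<lambda>p. \<phi> p $ i $ j) has_derivative (\<lambda>w. frechet_derivative \<phi> (at u) w $ i $ j)) (at u)" for i j
    using differentiable(1)[OF u] unfolding frechet_derivative_works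
    by (intro bounded_linear.has_derivative[OF bounded_linear_vec_nth])
  note eq = has_derivative_eq_on_open[OF open_S u _ L]
  have "frechet_derivative \<phi> (at u) w $ 1 $ 1 = - Db u w"
    by (rule eq[of 1 1 "\<lambda>p. - b p"]) (auto simp: normal_form intro!: derivative_eq_intros d)
  moreover have "frechet_derivative \<phi> (at u) w $ 1 $ 2 = - Dc u w"
    by (rule eq[of 1 2 "\<lambda>p. - c p"]) (auto simp: normal_form intro!: derivative_eq_intros d)
  moreover have "frechet_derivative \<phi> (at u) w $ 2 $ 2 = Db u w"
    by (rule eq[of 2 2 "\<lambda>p. b p"]) (auto simp: normal_form intro!: derivative_eq_intros d)
  moreover have "frechet_derivative \<phi> (at u) w $ 2 $ 1 = Da u w - 2 * u$2 * w$2"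
    by (rule eq[of 2 1 "\<lambda>p. a p - (p$2)\<^sup>2"]) (auto simp: normal_form intro!: derivative_eq_intros d)
  moreover have "frechet_derivative \<phi> (at u) w $ 3 $ 1 = - (Db u w * u$2 + b u * w$2)"
    by (rule eq[of 3 1 "\<lambda>p. - (b p * p$2)"]) (auto simp: normal_form intro!: derivative_eq_intros d)
  moreover have "frechet_derivative \<phi> (at u) w $ 3 $ 2 = - (Dc u w * u$2 + c u * w$2)"
    by (rule eq[of 3 2 "\<lambda>p. - (c p * p$2)"]) (auto simp: normal_form intro!: derivative_eq_intros d)
  moreover have "frechet_derivative \<phi> (at u) w $ 1 $ 3 = 0"
    by (rule eq[of 1 3 "\<lambda>p. 0"]) (auto simp: normal_form)
  moreover have "frechet_derivative \<phi> (at u) w $ 2 $ 3 = 0"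
    by (rule eq[of 2 3 "\<lambda>p. 0"]) (auto simp: normal_form)
  moreover have "frechet_derivative \<phi> (at u) w $ 3 $ 3 = 0"
    by (rule eq[of 3 3 "\<lambda>p. 0"]) (auto simp: normal_form)
  ultimately show ?thesis
    by (simp add: vec_eq_iff forall_3)
qed

text \<open>As \<open>\<xi>\<close> is constant, only the derivative of \<open>\<phi>\<close> along
  it remains, and its factor 2 cancels the 1/2 in \<open>h\<close>. Derivatives of the coordinate
  \<open>u$2\<close> drop out because \<open>axis 3 1\<close> has no second component.\<close>

lemma h_tensor_eq:
  assumes u: "u \<in> S"
  shows "h_tensor \<phi> \<xi> u = vector [vector [- partial_z b u, - partial_z c u, 0],
    vector [partial_z a u, partial_z b u, 0],
    vector [- (partial_z b u * u$2), - (partial_z c u * u$2), 0]]"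
proof -
  have "(\<xi> has_derivative frechet_derivative \<xi> (at u)) (at u)"
    using differentiable[OF u] frechet_derivative_works by blast
  from has_derivative_eq_on_open[OF open_S u normal_form(1) this has_derivative_const]
  have "frechet_derivative \<xi> (at u) v = 0" for v
    by simp
  moreover have "frechet_derivative \<phi> (at u) (2 *\<^sub>R axis 3 1) = 2 *\<^sub>R frechet_derivative \<phi> (at u) (axis 3 1)"
    using linear_cmul[OF linear_frechet_derivative] differentiable[OF u] by blast
  ultimately have "h_tensor \<phi> \<xi> u *v v = frechet_derivative \<phi> (at u) (axis 3 1) *v v" for v
    by (simp add: h_tensor_mult differentiable[OF u] normal_form(1)[OF u] flip: scaleR_matrix_vector_assoc)
  then have "h_tensor \<phi> \<xi> u = frechet_derivative \<phi> (at u) (axis 3 1)"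
    by (simp add: matrix_eq)
  then show ?thesis
    by (simp add: frechet_derivative_phi[OF u] partial_z_def axis_real3_nth)
qed

text \<open>The upper left block is traceless, so by Cayley-Hamilton it squares to minus its
  determinant times the identity. The third row of \<open>h\<close> is \<open>u$2\<close> times the
  first, and the square inherits this.\<close>

lemma h_tensor_square:
  assumes u: "u \<in> S"
  shows "h_tensor \<phi> \<xi> u ** h_tensor \<phi> \<xi> u = ((partial_z b u)\<^sup>2 - partial_z a u * partial_z c u)
    *\<^sub>R vector [vector [1, 0, 0], vector [0, 1, 0], vector [u$2, 0, 0]]"
  by (simp add: h_tensor_eq[OF u] matrix_matrix_mult_def vec_eq_iff forall_3 sum_3
      power2_eq_square algebra_simps)

lemma h_tensor_square_eq_0_iff:
  assumes u: "u \<in> S"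
  shows "h_tensor \<phi> \<xi> u ** h_tensor \<phi> \<xi> u = 0 \<longleftrightarrow> (partial_z b u)\<^sup>2 - partial_z a u * partial_z c u = 0"
  unfolding h_tensor_square[OF u] by (auto simp: vec_eq_iff forall_3)

text \<open>The matrix factor in \<open>h_tensor_square\<close> has trace 2.\<close>

lemma trace_h_tensor_square_eq_0_iff:
  assumes u: "u \<in> S"
  shows "trace (h_tensor \<phi> \<xi> u ** h_tensor \<phi> \<xi> u) = 0
    \<longleftrightarrow> (partial_z b u)\<^sup>2 - partial_z a u * partial_z c u = 0"
  unfolding h_tensor_square[OF u] by (auto simp: trace_def sum_3)

lemma normality_defect_eq_0_iff:
  assumes u: "u \<in> S"
  shows "(\<forall>v w. normality_defect \<phi> \<xi> \<eta> u v w = 0) \<longleftrightarrow>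
    partial_z a u = 0 \<and> partial_z b u = 0 \<and> partial_z c u = 0"
proof -
  note D = frechet_derivative_phi[OF u] frechet_derivative_eta[OF u]
  note lin = linear_frechet_derivative[OF differentiable(4)[OF u]]
    linear_frechet_derivative[OF differentiable(5)[OF u]]
    linear_frechet_derivative[OF differentiable(6)[OF u]]
  note expand = linear_real3_expand[OF lin(1)] linear_real3_expand[OF lin(2)] linear_real3_expand[OF lin(3)]
  have ac: "a u * c u - (b u)\<^sup>2 - c u * (u$2)\<^sup>2 = - 1"
    using normal_form(4)[OF u] .
  show ?thesis
  proof
    assume z: "\<forall>v w. normality_defect \<phi> \<xi> \<eta> u v w = 0"
    \<comment> \<open>The defect is tested on the third coordinate vector: \<open>\<phi>\<close>,
      the derivatives of \<open>\<phi>\<close> and the exterior derivative of \<open>\<eta>\<close>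
      all annihilate it, leaving a single term.\<close>
    have "\<phi> u *v axis 3 1 = 0"
      by (simp add: vec_eq_iff forall_3 matrix_vector_mult_real3_nth normal_form[OF u] axis_real3_nth)
    moreover have "frechet_derivative \<phi> (at u) w *v axis 3 1 = 0" for w
      by (simp add: vec_eq_iff forall_3 matrix_vector_mult_real3_nth D axis_real3_nth)
    moreover have "frechet_derivative \<phi> (at u) 0 = 0"
      using linear_0[OF linear_frechet_derivative[OF differentiable(1)[OF u]]] .
    ultimately have "normality_defect \<phi> \<xi> \<eta> u (axis 3 1) w = - (\<phi> u *v (frechet_derivative \<phi> (at u) (axis 3 1) *v w))" for w
      by (simp add: normality_defect_def D(2) inner_axis' axis_real3_nth)
    then have "\<phi> u *v (frechet_derivative \<phi> (at u) (axis 3 1) *v w) = 0" for w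
      using z by simp
    then have n: "(\<phi> u *v (frechet_derivative \<phi> (at u) (axis 3 1) *v w)) $ i = 0" for w i
      by simp
    have e1: "b u * partial_z b u - c u * partial_z a u = 0"
      "b u * partial_z a u - (a u - (u$2)\<^sup>2) * partial_z b u = 0"
      using n[of "axis 1 1" 1] n[of "axis 1 1" 2]
      by (simp_all add: matrix_vector_mult_real3_nth D normal_form[OF u] axis_real3_nth partial_z_def)
    have e2: "b u * partial_z c u - c u * partial_z b u = 0"
      "b u * partial_z b u - (a u - (u$2)\<^sup>2) * partial_z c u = 0"
      using n[of "axis 2 1" 1] n[of "axis 2 1" 2]
      by (simp_all add: matrix_vector_mult_real3_nth D normal_form[OF u] axis_real3_nth partial_z_def)
    \<comment> \<open>By \<open>ac\<close> the upper left block of \<open>\<phi>\<close> has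
      determinant -1, and \<open>e1\<close>, \<open>e2\<close> say that it kills the columns of the
      block of its \<open>z\<close>-derivative.\<close>
    show "partial_z a u = 0 \<and> partial_z b u = 0 \<and> partial_z c u = 0"
      using e1 e2 ac by algebra
  next
    assume z: "partial_z a u = 0 \<and> partial_z b u = 0 \<and> partial_z c u = 0"
    show "\<forall>v w. normality_defect \<phi> \<xi> \<eta> u v w = 0"
    proof (intro allI)
      fix v w
      define A1 where "A1 = Da u (axis 1 1)"
      define A2 where "A2 = Da u (axis 2 1)"
      define B1 where "B1 = Db u (axis 1 1)"
      define B2 where "B2 = Db u (axis 2 1)"
      define C1 where "C1 = Dc u (axis 1 1)"
      define C2 where "C2 = Dc u (axis 2 1)"
      have A: "Da u w = w$1 * A1 + w$2 * A2" for w
        using expand(1)[of w] z by (simp add: A1_def A2_def partial_z_def)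
      have B: "Db u w = w$1 * B1 + w$2 * B2" for w
        using expand(2)[of w] z by (simp add: B1_def B2_def partial_z_def)
      have C: "Dc u w = w$1 * C1 + w$2 * C2" for w
        using expand(3)[of w] z by (simp add: C1_def C2_def partial_z_def)
      have c1: "A1 * c u + a u * C1 - 2 * b u * B1 - C1 * (u$2)\<^sup>2 = 0"
        using constraint_derivative[OF u, of "axis 1 1"] by (simp add: A B C axis_real3_nth)
      have c2: "A2 * c u + a u * C2 - 2 * b u * B2 - C2 * (u$2)\<^sup>2 - 2 * c u * u$2 = 0"
        using constraint_derivative[OF u, of "axis 2 1"] by (simp add: A B C axis_real3_nth)
      \<comment> \<open>The first two components are multiples of the left-hand sides of
        \<open>c2\<close> and \<open>c1\<close>. The third combines \<open>c2\<close> with the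
        constraint itself, whose value -1 is balanced by the 1 coming from the term with
        \<open>\<xi>\<close>.\<close>
      have "normality_defect \<phi> \<xi> \<eta> u v w $ 1 = (v$2 * w$1 - v$1 * w$2)
          * (A2 * c u + a u * C2 - 2 * b u * B2 - C2 * (u$2)\<^sup>2 - 2 * c u * u$2)"
        unfolding normality_defect_def D
        by (simp add: normal_form[OF u] matrix_vector_mult_real3_nth A B C inner_axis' axis_real3_nth
            power2_eq_square algebra_simps)
      moreover have "normality_defect \<phi> \<xi> \<eta> u v w $ 2 = (v$1 * w$2 - v$2 * w$1)
          * (A1 * c u + a u * C1 - 2 * b u * B1 - C1 * (u$2)\<^sup>2)"
        unfolding normality_defect_def D
        by (simp add: normal_form[OF u] matrix_vector_mult_real3_nth A B C inner_axis' axis_real3_nth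
            power2_eq_square algebra_simps)
      moreover have "normality_defect \<phi> \<xi> \<eta> u v w $ 3 = (v$2 * w$1 - v$1 * w$2)
          * (u$2 * (A2 * c u + a u * C2 - 2 * b u * B2 - C2 * (u$2)\<^sup>2 - 2 * c u * u$2)
            + (a u * c u - (b u)\<^sup>2 - c u * (u$2)\<^sup>2) + 1)"
        unfolding normality_defect_def D
        by (simp add: normal_form[OF u] matrix_vector_mult_real3_nth A B C inner_axis' axis_real3_nth
            power2_eq_square algebra_simps)
      ultimately show "normality_defect \<phi> \<xi> \<eta> u v w = 0"
        unfolding c1 c2 ac by (simp add: vec_eq_iff forall_3)
    qed
  qed
qed

lemma parasasakian_on_iff:
  "parasasakian_on S \<phi> \<xi> \<eta> g \<longleftrightarrow> indep_of_z S a \<and> indep_of_z S b \<and> indep_of_z S c"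
proof -
  have "parasasakian_on S \<phi> \<xi> \<eta> g \<longleftrightarrow>
      (\<forall>u\<in>S. partial_z a u = 0 \<and> partial_z b u = 0 \<and> partial_z c u = 0)"
    using paracontact normality_defect_eq_0_iff
    by (auto simp: parasasakian_on_def normal_on_iff_normality_defect smooth)
  then show ?thesis
    using indep_of_z_iff_partial_z[OF open_S differentiable(4)]
      indep_of_z_iff_partial_z[OF open_S differentiable(5)]
      indep_of_z_iff_partial_z[OF open_S differentiable(6)] by auto
qed

end

section \<open>Passing to the manifold\<close>

lemma overlap_subset: "overlap \<kappa> \<kappa>' \<subseteq> chart_image \<kappa>"
  by (auto simp: overlap_def chart_image_def)

context
  fixes M :: "'m topology" and A :: "'m chart set"
  assumes manifold: "smooth_3_manifold M A"
begin

section \<open>Charts, transition maps and Jacobians\<close>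

lemma is_chart: "\<kappa> \<in> A \<Longrightarrow> is_chart M \<kappa>"
  using manifold by (simp add: smooth_3_manifold_def)

lemma inj_on_chart:
  assumes "\<kappa> \<in> A"
  shows "inj_on (snd \<kappa>) (fst \<kappa>)"
proof -
  have "topspace (subtopology M (fst \<kappa>)) = fst \<kappa>"
    using is_chart[OF assms] by (auto simp: is_chart_def dest: openin_subset)
  then show ?thesis
    using is_chart[OF assms] homeomorphic_imp_injective_map by (metis is_chart_def)
qed

lemma open_chart_image: "\<kappa> \<in> A \<Longrightarrow> open (chart_image \<kappa>)"
  using is_chart by (auto simp: is_chart_def)

text \<open>The coordinate map is a homeomorphism onto an open set, so it takes the open
  intersection of the domains to an open set.\<close>

lemma open_overlap:
  assumes "\<kappa> \<in> A" "\<kappa>' \<in> A"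
  shows "open (overlap \<kappa> \<kappa>')"
proof -
  have o: "openin M (fst \<kappa>)" "openin M (fst \<kappa>')"
    using assms is_chart by (auto simp: is_chart_def)
  then have "openin (subtopology M (fst \<kappa>)) (fst \<kappa> \<inter> fst \<kappa>')"
    by (metis openin_subtopology inf_commute)
  then have "openin (top_of_set (chart_image \<kappa>)) (overlap \<kappa> \<kappa>')"
    using is_chart[OF assms(1)] homeomorphic_map_openness_eq unfolding overlap_def is_chart_def by metis
  then show ?thesis
    using open_chart_image[OF assms(1)] openin_open_trans by blast
qed

lemma transition_in_overlap:
  assumes "\<kappa> \<in> A" "u \<in> overlap \<kappa> \<kappa>'"
  shows "transition \<kappa> \<kappa>' u \<in> overlap \<kappa>' \<kappa>"
  using assms inv_into_f_f[OF inj_on_chart[OF assms(1)]] by (auto simp: overlap_def transition_def)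

lemma transition_transition:
  assumes "\<kappa> \<in> A" "\<kappa>' \<in> A" "u \<in> overlap \<kappa> \<kappa>'"
  shows "transition \<kappa>' \<kappa> (transition \<kappa> \<kappa>' u) = u"
  using assms inv_into_f_f[OF inj_on_chart[OF assms(1)]] inv_into_f_f[OF inj_on_chart[OF assms(2)]]
  by (auto simp: overlap_def transition_def)

lemma smooth_transition:
  assumes "\<kappa> \<in> A" "\<kappa>' \<in> A"
  shows "smooth_on (overlap \<kappa> \<kappa>') (transition \<kappa> \<kappa>')"
  using assms manifold by (auto simp: smooth_3_manifold_def compatible_def)

lemma coordinate_change_transition:
  assumes "\<kappa> \<in> A" "\<kappa>' \<in> A" "u \<in> overlap \<kappa> \<kappa>'"
  obtains K where "coordinate_change (overlap \<kappa> \<kappa>') u (transition \<kappa> \<kappa>') (jacobian \<kappa> \<kappa>') K"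
  using coordinate_change_smooth[OF open_overlap[OF assms(1,2)] assms(3) smooth_transition[OF assms(1,2)]]
  unfolding jacobian_def[abs_def] by blast

text \<open>Chain rule for the composite of the two transitions, which is the identity on the
  overlap. It allows Jacobians to be cancelled when passing between charts.\<close>

lemma jacobian_inverse:
  assumes "\<kappa> \<in> A" "\<kappa>' \<in> A" "u \<in> overlap \<kappa> \<kappa>'"
  shows "jacobian \<kappa>' \<kappa> (transition \<kappa> \<kappa>' u) ** jacobian \<kappa> \<kappa>' u = mat 1"
proof -
  obtain K where K: "coordinate_change (overlap \<kappa> \<kappa>') u (transition \<kappa> \<kappa>') (jacobian \<kappa> \<kappa>') K"
    using coordinate_change_transition[OF assms] .
  obtain K' where K': "coordinate_change (overlap \<kappa>' \<kappa>) (transition \<kappa> \<kappa>' u) (transition \<kappa>' \<kappa>) (jacobian \<kappa>' \<kappa>) K'"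
    using coordinate_change_transition[OF assms(2,1) transition_in_overlap[OF assms(1,3)]] .
  have "((\<lambda>p. transition \<kappa>' \<kappa> (transition \<kappa> \<kappa>' p)) has_derivative
      (\<lambda>v. jacobian \<kappa>' \<kappa> (transition \<kappa> \<kappa>' u) *v (jacobian \<kappa> \<kappa>' u *v v))) (at u)"
    using has_derivative_compose[OF coordinate_change.T[OF K] coordinate_change.T[OF K']] .
  from has_derivative_eq_on_open[OF open_overlap[OF assms(1,2)] assms(3) _ this has_derivative_ident]
  have "jacobian \<kappa>' \<kappa> (transition \<kappa> \<kappa>' u) *v (jacobian \<kappa> \<kappa>' u *v v) = v" for v
    using transition_transition[OF assms(1,2)] by simp
  then show ?thesis
    by (simp add: matrix_eq flip: matrix_vector_mul_assoc)
qed

lemma obtain_covering_chart: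
  assumes "covers M D" "\<kappa> \<in> A" "u \<in> chart_image \<kappa>"
  obtains \<kappa>' where "\<kappa>' \<in> D" "u \<in> overlap \<kappa> \<kappa>'"
proof -
  obtain m where m: "m \<in> fst \<kappa>" "u = snd \<kappa> m"
    using assms(3) by (auto simp: chart_image_def)
  have "m \<in> topspace M"
    using m(1) is_chart[OF assms(2)] openin_subset by (auto simp: is_chart_def)
  then obtain \<kappa>' where "\<kappa>' \<in> D" "m \<in> fst \<kappa>'"
    using assms(1) unfolding covers_def by blast
  then show ?thesis
    using that m by (auto simp: overlap_def)
qed

context
  fixes \<phi> g :: "'m chart \<Rightarrow> tensor3" and \<xi> \<eta> :: "'m chart \<Rightarrow> field3"
  assumes paracontact: "paracontact_metric A \<phi> \<xi> \<eta> g"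
begin

section \<open>Transfer of normality and of \<open>h\<close> between charts\<close>

lemma paracontact_differentiable:
  assumes "\<kappa> \<in> A" "u \<in> chart_image \<kappa>"
  shows "\<phi> \<kappa> differentiable (at u)" "\<xi> \<kappa> differentiable (at u)" "\<eta> \<kappa> differentiable (at u)"
  using assms paracontact smooth_on_imp_differentiable
  by (auto simp: paracontact_metric_def paracontact_metric_on_def almost_paracontact_on_def)

lemma normality_defect_transition:
  assumes "\<kappa> \<in> A" "\<kappa>' \<in> A" "u \<in> overlap \<kappa> \<kappa>'"
  shows "normality_defect (\<phi> \<kappa>') (\<xi> \<kappa>') (\<eta> \<kappa>') (transition \<kappa> \<kappa>' u) (jacobian \<kappa> \<kappa>' u *v v) (jacobian \<kappa> \<kappa>' u *v w)
    = jacobian \<kappa> \<kappa>' u *v normality_defect (\<phi> \<kappa>) (\<xi> \<kappa>) (\<eta> \<kappa>) u v w"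
proof -
  obtain K where "coordinate_change (overlap \<kappa> \<kappa>') u (transition \<kappa> \<kappa>') (jacobian \<kappa> \<kappa>') K"
    using coordinate_change_transition[OF assms] .
  then interpret coordinate_change "overlap \<kappa> \<kappa>'" u "transition \<kappa> \<kappa>'" "jacobian \<kappa> \<kappa>'" K .
  have "u \<in> chart_image \<kappa>" "transition \<kappa> \<kappa>' u \<in> chart_image \<kappa>'"
    using assms transition_in_overlap overlap_subset by blast+
  then show ?thesis
    using paracontact assms(1,2)
    by (intro normality_defect_transform paracontact_differentiable)
      (auto simp: paracontact_metric_def tensor_1_1_def vector_field_def one_form_def)
qed

lemma h_tensor_transition:
  assumes "\<kappa> \<in> A" "\<kappa>' \<in> A" "u \<in> overlap \<kappa> \<kappa>'"
  shows "h_tensor (\<phi> \<kappa>') (\<xi> \<kappa>') (transition \<kappa> \<kappa>' u) ** jacobian \<kappa> \<kappa>' u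
    = jacobian \<kappa> \<kappa>' u ** h_tensor (\<phi> \<kappa>) (\<xi> \<kappa>) u"
proof -
  obtain K where "coordinate_change (overlap \<kappa> \<kappa>') u (transition \<kappa> \<kappa>') (jacobian \<kappa> \<kappa>') K"
    using coordinate_change_transition[OF assms] .
  then interpret coordinate_change "overlap \<kappa> \<kappa>'" u "transition \<kappa> \<kappa>'" "jacobian \<kappa> \<kappa>'" K .
  have "u \<in> chart_image \<kappa>" "transition \<kappa> \<kappa>' u \<in> chart_image \<kappa>'"
    using assms transition_in_overlap overlap_subset by blast+
  then show ?thesis
    using paracontact assms(1,2)
    by (intro h_tensor_transform paracontact_differentiable)
      (auto simp: paracontact_metric_def tensor_1_1_def vector_field_def)
qed

text \<open>Each point of the chart also lies in a chart of \<open>D\<close>, where the defect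
  vanishes; the transformation law and the left inverse of the Jacobian carry this back.\<close>

lemma normal_from_cover:
  assumes "D \<subseteq> A" "covers M D"
    and normal: "\<And>\<kappa>. \<kappa> \<in> D \<Longrightarrow> normal_on (chart_image \<kappa>) (\<phi> \<kappa>) (\<xi> \<kappa>) (\<eta> \<kappa>)"
    and \<kappa>: "\<kappa> \<in> A"
  shows "normal_on (chart_image \<kappa>) (\<phi> \<kappa>) (\<xi> \<kappa>) (\<eta> \<kappa>)"
proof -
  have sm: "smooth_on (chart_image \<kappa>) (\<phi> \<kappa>)" "smooth_on (chart_image \<kappa>) (\<eta> \<kappa>)" if "\<kappa> \<in> A" for \<kappa>
    using paracontact that
    by (auto simp: paracontact_metric_def paracontact_metric_on_def almost_paracontact_on_def)
  have "normality_defect (\<phi> \<kappa>) (\<xi> \<kappa>) (\<eta> \<kappa>) u v w = 0" if u: "u \<in> chart_image \<kappa>" for u v w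
  proof -
    obtain \<kappa>' where \<kappa>': "\<kappa>' \<in> D" "u \<in> overlap \<kappa> \<kappa>'"
      using obtain_covering_chart[OF assms(2) \<kappa> u] .
    have A': "\<kappa>' \<in> A"
      using \<kappa>' assms(1) by blast
    let ?J = "jacobian \<kappa> \<kappa>' u"
    have "transition \<kappa> \<kappa>' u \<in> chart_image \<kappa>'"
      using \<kappa>'(2) \<kappa> transition_in_overlap overlap_subset by blast
    then have "normality_defect (\<phi> \<kappa>') (\<xi> \<kappa>') (\<eta> \<kappa>') (transition \<kappa> \<kappa>' u) (?J *v v) (?J *v w) = 0"
      using normal[OF \<kappa>'(1)] normal_on_iff_normality_defect[OF sm[OF A']] by blast
    then have "?J *v normality_defect (\<phi> \<kappa>) (\<xi> \<kappa>) (\<eta> \<kappa>) u v w = 0"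
      by (simp add: normality_defect_transition[OF \<kappa> A' \<kappa>'(2)])
    then have "(jacobian \<kappa>' \<kappa> (transition \<kappa> \<kappa>' u) ** ?J) *v normality_defect (\<phi> \<kappa>) (\<xi> \<kappa>) (\<eta> \<kappa>) u v w = 0"
      by (simp flip: matrix_vector_mul_assoc)
    then show ?thesis
      by (simp add: jacobian_inverse[OF \<kappa> A' \<kappa>'(2)])
  qed
  then show ?thesis
    by (simp add: normal_on_iff_normality_defect[OF sm[OF \<kappa>]])
qed

lemma h_tensor_square_from_cover:
  assumes "D \<subseteq> A" "covers M D"
    and h: "\<And>\<kappa> u. \<kappa> \<in> D \<Longrightarrow> u \<in> chart_image \<kappa> \<Longrightarrow> h_tensor (\<phi> \<kappa>) (\<xi> \<kappa>) u ** h_tensor (\<phi> \<kappa>) (\<xi> \<kappa>) u = 0"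
    and \<kappa>: "\<kappa> \<in> A" and u: "u \<in> chart_image \<kappa>"
  shows "h_tensor (\<phi> \<kappa>) (\<xi> \<kappa>) u ** h_tensor (\<phi> \<kappa>) (\<xi> \<kappa>) u = 0"
proof -
  obtain \<kappa>' where \<kappa>': "\<kappa>' \<in> D" "u \<in> overlap \<kappa> \<kappa>'"
    using obtain_covering_chart[OF assms(2) \<kappa> u] .
  have A': "\<kappa>' \<in> A"
    using \<kappa>' assms(1) by blast
  let ?J = "jacobian \<kappa> \<kappa>' u" and ?I = "jacobian \<kappa>' \<kappa> (transition \<kappa> \<kappa>' u)"
  let ?h = "h_tensor (\<phi> \<kappa>) (\<xi> \<kappa>) u" and ?h' = "h_tensor (\<phi> \<kappa>') (\<xi> \<kappa>') (transition \<kappa> \<kappa>' u)"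
  have "transition \<kappa> \<kappa>' u \<in> chart_image \<kappa>'"
    using \<kappa>'(2) \<kappa> transition_in_overlap overlap_subset by blast
  then have h': "?h' ** ?h' = 0"
    using h[OF \<kappa>'(1)] by blast
  have hJ: "?h' ** ?J = ?J ** ?h"
    using h_tensor_transition[OF \<kappa> A' \<kappa>'(2)] .
  have "?h ** ?h = ?I ** ?J ** (?h ** ?h)"
    by (simp add: jacobian_inverse[OF \<kappa> A' \<kappa>'(2)])
  also have "\<dots> = ?I ** ((?J ** ?h) ** ?h)"
    by (simp add: matrix_mul_assoc)
  \<comment> \<open>The Jacobian is moved past both factors by using \<open>hJ\<close>
    twice.\<close>
  also have "\<dots> = ?I ** ((?h' ** ?h') ** ?J)"
    by (metis hJ matrix_mul_assoc)
  finally show ?thesis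
    by (simp add: h')
qed

lemma darboux_locale:
  assumes "darboux_chart A \<eta> \<kappa>"
  shows "darboux (chart_image \<kappa>) (\<phi> \<kappa>) (\<xi> \<kappa>) (\<eta> \<kappa>) (g \<kappa>)"
  using assms paracontact
  by (intro darboux.intro open_chart_image) (simp_all add: darboux_chart_def paracontact_metric_def)

lemma parasasakian_iff_cover:
  assumes "D \<subseteq> A" "covers M D"
  shows "parasasakian A \<phi> \<xi> \<eta> g \<longleftrightarrow>
    (\<forall>\<kappa>\<in>D. parasasakian_on (chart_image \<kappa>) (\<phi> \<kappa>) (\<xi> \<kappa>) (\<eta> \<kappa>) (g \<kappa>))"
  using paracontact normal_from_cover[OF assms] assms(1)
  unfolding parasasakian_def parasasakian_on_def paracontact_metric_def by blast

end

end

text \<open>The criteria come in two forms: on a single Darboux chart, and on the whole manifold,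
  where they are tested on any family of Darboux charts covering \<open>M\<close>.\<close>

theorem proposition4p2:
  fixes M :: "'m topology" and A :: "'m chart set"
    and \<phi> g :: "'m chart \<Rightarrow> tensor3" and \<xi> \<eta> :: "'m chart \<Rightarrow> field3"
  assumes "smooth_3_manifold M A" and "connected_space M"
    and "paracontact_metric A \<phi> \<xi> \<eta> g"
  shows "\<exists>a b c :: 'm chart \<Rightarrow> real^3 \<Rightarrow> real.
    (\<forall>\<kappa>. darboux_chart A \<eta> \<kappa> \<longrightarrow>
       smooth_on (chart_image \<kappa>) (a \<kappa>) \<and>
       smooth_on (chart_image \<kappa>) (b \<kappa>) \<and>
       smooth_on (chart_image \<kappa>) (c \<kappa>) \<and>
       (\<forall>u\<in>chart_image \<kappa>.
          a \<kappa> u * c \<kappa> u - (b \<kappa> u)\<^sup>2 - c \<kappa> u * (u$2)\<^sup>2 = - 1 \<and>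
          \<xi> \<kappa> u = 2 *\<^sub>R axis 3 1 \<and>
          \<eta> \<kappa> u = (1/2) *\<^sub>R (axis 3 1 - u$2 *\<^sub>R axis 1 1) \<and>
          g \<kappa> u = (1/4) *\<^sub>R vector [vector [a \<kappa> u, b \<kappa> u, - (u$2)],
                                    vector [b \<kappa> u, c \<kappa> u, 0],
                                    vector [- (u$2), 0, 1]] \<and>
          \<phi> \<kappa> u = vector [vector [- b \<kappa> u, - c \<kappa> u, 0],
                            vector [a \<kappa> u - (u$2)\<^sup>2, b \<kappa> u, 0],
                            vector [- (b \<kappa> u * u$2), - (c \<kappa> u * u$2), 0]]) \<and>
       (parasasakian_on (chart_image \<kappa>) (\<phi> \<kappa>) (\<xi> \<kappa>) (\<eta> \<kappa>) (g \<kappa>) \<longleftrightarrow>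
          indep_of_z (chart_image \<kappa>) (a \<kappa>) \<and>
          indep_of_z (chart_image \<kappa>) (b \<kappa>) \<and>
          indep_of_z (chart_image \<kappa>) (c \<kappa>)) \<and>
       ((\<forall>u\<in>chart_image \<kappa>. h_tensor (\<phi> \<kappa>) (\<xi> \<kappa>) u ** h_tensor (\<phi> \<kappa>) (\<xi> \<kappa>) u = 0) \<longleftrightarrow>
        (\<forall>u\<in>chart_image \<kappa>.
           (partial_z (b \<kappa>) u)\<^sup>2 - partial_z (a \<kappa>) u * partial_z (c \<kappa>) u = 0)) \<and>
       ((\<forall>u\<in>chart_image \<kappa>. h_tensor (\<phi> \<kappa>) (\<xi> \<kappa>) u ** h_tensor (\<phi> \<kappa>) (\<xi> \<kappa>) u = 0) \<longleftrightarrow>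
        (\<forall>u\<in>chart_image \<kappa>.
           trace (h_tensor (\<phi> \<kappa>) (\<xi> \<kappa>) u ** h_tensor (\<phi> \<kappa>) (\<xi> \<kappa>) u) = 0))) \<and>
    (\<forall>D. (\<forall>\<kappa>\<in>D. darboux_chart A \<eta> \<kappa>) \<and> covers M D \<longrightarrow>
       (parasasakian A \<phi> \<xi> \<eta> g \<longleftrightarrow>
          (\<forall>\<kappa>\<in>D. indep_of_z (chart_image \<kappa>) (a \<kappa>) \<and>
                 indep_of_z (chart_image \<kappa>) (b \<kappa>) \<and>
                 indep_of_z (chart_image \<kappa>) (c \<kappa>))) \<and>
       ((\<forall>\<kappa>\<in>A. \<forall>u\<in>chart_image \<kappa>.
           h_tensor (\<phi> \<kappa>) (\<xi> \<kappa>) u ** h_tensor (\<phi> \<kappa>) (\<xi> \<kappa>) u = 0) \<longleftrightarrow>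
        (\<forall>\<kappa>\<in>D. \<forall>u\<in>chart_image \<kappa>.
           (partial_z (b \<kappa>) u)\<^sup>2 - partial_z (a \<kappa>) u * partial_z (c \<kappa>) u = 0)) \<and>
       ((\<forall>\<kappa>\<in>A. \<forall>u\<in>chart_image \<kappa>.
           h_tensor (\<phi> \<kappa>) (\<xi> \<kappa>) u ** h_tensor (\<phi> \<kappa>) (\<xi> \<kappa>) u = 0) \<longleftrightarrow>
        (\<forall>\<kappa>\<in>A. \<forall>u\<in>chart_image \<kappa>.
           trace (h_tensor (\<phi> \<kappa>) (\<xi> \<kappa>) u ** h_tensor (\<phi> \<kappa>) (\<xi> \<kappa>) u) = 0)))"
proof -
  let ?S = "chart_image" and ?h = "\<lambda>\<kappa>. h_tensor (\<phi> \<kappa>) (\<xi> \<kappa>)"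
  \<comment> \<open>These locale constants depend on \<open>g\<close> alone: in every chart they are
    four times the upper left entries of \<open>g\<close>.\<close>
  define a b c where "a \<kappa> = darboux.a (g \<kappa>)" and "b \<kappa> = darboux.b (g \<kappa>)" and "c \<kappa> = darboux.c (g \<kappa>)"
    for \<kappa> :: "'m chart"
  note abc = a_def b_def c_def
  have loc: "darboux (chart_image \<kappa>) (\<phi> \<kappa>) (\<xi> \<kappa>) (\<eta> \<kappa>) (g \<kappa>)" if "darboux_chart A \<eta> \<kappa>" for \<kappa>
    using darboux_locale[OF assms(1,3) that] .
  have square: "?h \<kappa> u ** ?h \<kappa> u = 0 \<longleftrightarrow>
      (partial_z (b \<kappa>) u)\<^sup>2 - partial_z (a \<kappa>) u * partial_z (c \<kappa>) u = 0"
    and trace_square: "trace (?h \<kappa> u ** ?h \<kappa> u) = 0 \<longleftrightarrow> ?h \<kappa> u ** ?h \<kappa> u = 0"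
    if "darboux_chart A \<eta> \<kappa>" "u \<in> chart_image \<kappa>" for \<kappa> u
    using darboux.h_tensor_square_eq_0_iff[OF loc[OF that(1)] that(2)]
      darboux.trace_h_tensor_square_eq_0_iff[OF loc[OF that(1)] that(2)]
    by (simp_all add: abc)
  have sasaki: "parasasakian_on (chart_image \<kappa>) (\<phi> \<kappa>) (\<xi> \<kappa>) (\<eta> \<kappa>) (g \<kappa>) \<longleftrightarrow>
      indep_of_z (chart_image \<kappa>) (a \<kappa>) \<and> indep_of_z (chart_image \<kappa>) (b \<kappa>) \<and> indep_of_z (chart_image \<kappa>) (c \<kappa>)"
    if "darboux_chart A \<eta> \<kappa>" for \<kappa>
    using darboux.parasasakian_on_iff[OF loc[OF that]] by (simp add: abc)
  show ?thesis
  proof (rule exI[of _ a], rule exI[of _ b], rule exI[of _ c], intro conjI allI impI)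
    fix \<kappa> assume \<kappa>: "darboux_chart A \<eta> \<kappa>"
    interpret L: darboux "chart_image \<kappa>" "\<phi> \<kappa>" "\<xi> \<kappa>" "\<eta> \<kappa>" "g \<kappa>"
      using loc[OF \<kappa>] .
    show "smooth_on (?S \<kappa>) (a \<kappa>)" "smooth_on (?S \<kappa>) (b \<kappa>)" "smooth_on (?S \<kappa>) (c \<kappa>)"
      using L.smooth_abc by (simp_all add: abc)
    show "(\<forall>u\<in>chart_image \<kappa>.
          a \<kappa> u * c \<kappa> u - (b \<kappa> u)\<^sup>2 - c \<kappa> u * (u$2)\<^sup>2 = - 1 \<and>
          \<xi> \<kappa> u = 2 *\<^sub>R axis 3 1 \<and>
          \<eta> \<kappa> u = (1/2) *\<^sub>R (axis 3 1 - u$2 *\<^sub>R axis 1 1) \<and>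
          g \<kappa> u = (1/4) *\<^sub>R vector [vector [a \<kappa> u, b \<kappa> u, - (u$2)],
                                    vector [b \<kappa> u, c \<kappa> u, 0],
                                    vector [- (u$2), 0, 1]] \<and>
          \<phi> \<kappa> u = vector [vector [- b \<kappa> u, - c \<kappa> u, 0],
                            vector [a \<kappa> u - (u$2)\<^sup>2, b \<kappa> u, 0],
                            vector [- (b \<kappa> u * u$2), - (c \<kappa> u * u$2), 0]])"
      using L.normal_form L.\<eta> by (simp add: abc)
    show "parasasakian_on (?S \<kappa>) (\<phi> \<kappa>) (\<xi> \<kappa>) (\<eta> \<kappa>) (g \<kappa>) \<longleftrightarrow>
        indep_of_z (?S \<kappa>) (a \<kappa>) \<and> indep_of_z (?S \<kappa>) (b \<kappa>) \<and> indep_of_z (?S \<kappa>) (c \<kappa>)"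
      using sasaki[OF \<kappa>] .
    show "(\<forall>u\<in>?S \<kappa>. ?h \<kappa> u ** ?h \<kappa> u = 0) \<longleftrightarrow>
        (\<forall>u\<in>?S \<kappa>. (partial_z (b \<kappa>) u)\<^sup>2 - partial_z (a \<kappa>) u * partial_z (c \<kappa>) u = 0)"
      using square[OF \<kappa>] by blast
    show "(\<forall>u\<in>?S \<kappa>. ?h \<kappa> u ** ?h \<kappa> u = 0) \<longleftrightarrow> (\<forall>u\<in>?S \<kappa>. trace (?h \<kappa> u ** ?h \<kappa> u) = 0)"
      using trace_square[OF \<kappa>] by blast
  next
    fix D assume D: "(\<forall>\<kappa>\<in>D. darboux_chart A \<eta> \<kappa>) \<and> covers M D"
    then have DA: "D \<subseteq> A" and dar: "\<And>\<kappa>. \<kappa> \<in> D \<Longrightarrow> darboux_chart A \<eta> \<kappa>" and cov: "covers M D"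
      by (auto simp: darboux_chart_def)
    note h_square = h_tensor_square_from_cover[OF assms(1,3) DA cov]
    show "parasasakian A \<phi> \<xi> \<eta> g \<longleftrightarrow>
        (\<forall>\<kappa>\<in>D. indep_of_z (?S \<kappa>) (a \<kappa>) \<and> indep_of_z (?S \<kappa>) (b \<kappa>) \<and> indep_of_z (?S \<kappa>) (c \<kappa>))"
      using parasasakian_iff_cover[OF assms(1,3) DA cov] sasaki dar by simp
    show "(\<forall>\<kappa>\<in>A. \<forall>u\<in>?S \<kappa>. ?h \<kappa> u ** ?h \<kappa> u = 0) \<longleftrightarrow>
        (\<forall>\<kappa>\<in>D. \<forall>u\<in>?S \<kappa>. (partial_z (b \<kappa>) u)\<^sup>2 - partial_z (a \<kappa>) u * partial_z (c \<kappa>) u = 0)"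
      using h_square square dar DA by blast
    show "(\<forall>\<kappa>\<in>A. \<forall>u\<in>?S \<kappa>. ?h \<kappa> u ** ?h \<kappa> u = 0) \<longleftrightarrow>
        (\<forall>\<kappa>\<in>A. \<forall>u\<in>?S \<kappa>. trace (?h \<kappa> u ** ?h \<kappa> u) = 0)"
    proof
      assume "\<forall>\<kappa>\<in>A. \<forall>u\<in>?S \<kappa>. ?h \<kappa> u ** ?h \<kappa> u = 0"
      then show "\<forall>\<kappa>\<in>A. \<forall>u\<in>?S \<kappa>. trace (?h \<kappa> u ** ?h \<kappa> u) = 0"
        by (simp add: trace_def)
    next
      assume "\<forall>\<kappa>\<in>A. \<forall>u\<in>?S \<kappa>. trace (?h \<kappa> u ** ?h \<kappa> u) = 0"
      then show "\<forall>\<kappa>\<in>A. \<forall>u\<in>?S \<kappa>. ?h \<kappa> u ** ?h \<kappa> u = 0"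
        \<comment> \<open>Vanishing trace gives vanishing square on the Darboux charts in
          \<open>D\<close>, and \<open>h_square\<close> extends this to all charts.\<close>
        using h_square trace_square dar DA by blast
    qed
  qed
qed

end
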